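(* Let $d\geq1$, $n\geq1$, $0<\epsilon<1$, and $f\in F_{d,n}$. There exists a rational neural network $\mathcal{N}_{\text{Rational}}$ of size $$\mathcal{O}(\epsilon^{-d/n}\log(\log(1/\epsilon)))$$ and maximum depth $\mathcal{O}(\log(\log(1/\epsilon)))$ such that $\|f-\mathcal{N}_{\text{Rational}}\|_\infty\leq\epsilon$, where $\|\cdot\|_\infty$ is the supremum norm on $[0,1]^d$.
   Context: $F_{d,n}=\{f\in\mathcal{W}^{n,\infty}([0,1]^d):\|f\|_{\mathcal{W}^{n,\infty}([0,1]^d)}\le1\}$, where $\|f\|_{\mathcal{W}^{n,\infty}([0,1]^d)}=\max_{|\mathbf{n}|\le n}\operatorname{ess\,sup}_{\mathbf{x}\in[0,1]^d}|D^{\mathbf{n}}f(\mathbf{x})|$, with multi-indices $\mathbf{n}$ and weak derivatives $D^{\mathbf{n}}f$. A feedforward neural network is arranged in layers of nodes; each node applies a scalar activation function to an affine function of the outputs of earlier layers (of the input, for the first layer), and the network output is an affine combination of node outputs. A rational neural network is one whose activations are univariate rational functions of type at most $(3,2)$ (numerator degree at most 3, denominator degree at most 2), possibly different from node to node. Size is the total number of nodes and depth is the number of layers. The $\mathcal{O}$ bounds are understood as $\epsilon\to0$, with implied constants depending only on $d$ and $n$. *)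

theory Defs
  imports
    "HOL-Analysis.Analysis"
    "HOL-Probability.Essential_Supremum"
    "HOL-Computational_Algebra.Polynomial"
    "HOL-Library.Landau_Symbols"
begin

section \<open>The Sobolev unit ball on the unit cube\<close>

abbreviation unit_cube :: "(real^'d) set"
  where "unit_cube \<equiv> cbox 0 1"

definition partial_deriv :: "'d \<Rightarrow> (real^'d \<Rightarrow> real) \<Rightarrow> real^'d \<Rightarrow> real"
  where "partial_deriv i \<phi> x = deriv (\<lambda>t. \<phi> (x + t *\<^sub>R axis i 1)) 0"

primrec iter_partial :: "'d list \<Rightarrow> (real^'d \<Rightarrow> real) \<Rightarrow> real^'d \<Rightarrow> real"
  where
    "iter_partial [] \<phi> = \<phi>"
  | "iter_partial (i # is) \<phi> = partial_deriv i (iter_partial is \<phi>)"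

definition smooth :: "(real^'d \<Rightarrow> real) \<Rightarrow> bool"
  where "smooth \<phi> \<longleftrightarrow>
    (\<forall>is. continuous_on UNIV (iter_partial is \<phi>) \<and>
      (\<forall>i x. (\<lambda>t. iter_partial is \<phi> (x + t *\<^sub>R axis i 1)) differentiable (at (0::real))))"

definition test_function :: "(real^'d \<Rightarrow> real) \<Rightarrow> bool"
  where "test_function \<phi> \<longleftrightarrow>
    smooth \<phi> \<and> compact (closure {x. \<phi> x \<noteq> 0}) \<and> closure {x. \<phi> x \<noteq> 0} \<subseteq> box 0 1"

definition mi_order :: "nat^'d \<Rightarrow> nat"
  where "mi_order k = (\<Sum>i\<in>UNIV. k $ i)"

text \<open>The order in which the partial derivatives are taken is arbitrary: the index type carries
  no order, and partial derivatives of a smooth function commute.\<close>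

definition mi_deriv :: "nat^'d \<Rightarrow> (real^'d \<Rightarrow> real) \<Rightarrow> real^'d \<Rightarrow> real"
  where "mi_deriv k \<phi> = iter_partial (SOME is. \<forall>i. count_list is i = k $ i) \<phi>"

definition locally_integrable :: "(real^'d \<Rightarrow> real) \<Rightarrow> bool"
  where "locally_integrable f \<longleftrightarrow>
    (\<forall>K. compact K \<and> K \<subseteq> box 0 1 \<longrightarrow> set_integrable lebesgue K f)"

definition has_weak_deriv :: "(real^'d \<Rightarrow> real) \<Rightarrow> nat^'d \<Rightarrow> (real^'d \<Rightarrow> real) \<Rightarrow> bool"
  where "has_weak_deriv f k g \<longleftrightarrow>
    locally_integrable f \<and> locally_integrable g \<and>
    (\<forall>\<phi>. test_function \<phi> \<longrightarrow>
      (LINT x:box 0 1|lebesgue. f x * mi_deriv k \<phi> x) =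
      (- 1) ^ mi_order k * (LINT x:box 0 1|lebesgue. g x * \<phi> x))"

text \<open>Weak derivatives are unique up to null sets, so the choice does not affect essential
  suprema.\<close>

definition weak_deriv :: "(real^'d \<Rightarrow> real) \<Rightarrow> nat^'d \<Rightarrow> real^'d \<Rightarrow> real"
  where "weak_deriv f k = (SOME g. has_weak_deriv f k g)"

text \<open>The explicit case distinction is needed because \<open>\<bar>f\<bar>\<close> may be measurable when \<open>f\<close> is not.\<close>

definition Linf_norm :: "(real^'d \<Rightarrow> real) \<Rightarrow> ereal"
  where "Linf_norm f =
    (if f \<in> borel_measurable (lebesgue_on unit_cube)
     then esssup (lebesgue_on unit_cube) (\<lambda>x. ereal \<bar>f x\<bar>) else \<infinity>)"

definition sobolev_space :: "nat \<Rightarrow> (real^'d \<Rightarrow> real) set"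
  where "sobolev_space n =
    {f. Linf_norm f < \<infinity> \<and>
        (\<forall>k. mi_order k \<le> n \<longrightarrow> (\<exists>g. has_weak_deriv f k g \<and> Linf_norm g < \<infinity>))}"

definition sobolev_norm :: "nat \<Rightarrow> (real^'d \<Rightarrow> real) \<Rightarrow> ereal"
  where "sobolev_norm n f = Max ((\<lambda>k. Linf_norm (weak_deriv f k)) ` {k. mi_order k \<le> n})"

definition sobolev_ball :: "nat \<Rightarrow> (real^'d \<Rightarrow> real) set"
  where "sobolev_ball n = {f \<in> sobolev_space n. sobolev_norm n f \<le> 1}"

text \<open>Elements of the Sobolev space are only determined almost everywhere; their values at points
  are those of the continuous representative.\<close>

definition continuous_representative :: "(real^'d \<Rightarrow> real) \<Rightarrow> (real^'d \<Rightarrow> real) \<Rightarrow> bool"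
  where "continuous_representative f g \<longleftrightarrow>
    continuous_on unit_cube g \<and> (AE x in lebesgue_on unit_cube. g x = f x)"

definition sup_norm :: "(real^'d \<Rightarrow> real) \<Rightarrow> ereal"
  where "sup_norm h = (SUP x\<in>unit_cube. ereal \<bar>h x\<bar>)"


section \<open>Rational neural networks\<close>

text \<open>A node maps the values \<open>v i\<close>, \<open>i \<in> I\<close>, to \<open>r (b + (\<Sum>i\<in>I. w i * v i))\<close>, where the
  activation \<open>r\<close> is the quotient of the polynomials \<open>num\<close> and \<open>den\<close>.\<close>

datatype 'i node =
  Node (weight: "'i \<Rightarrow> real") (bias: real) (num: "real poly") (den: "real poly")

definition rational_node :: "'i node \<Rightarrow> bool"
  where "rational_node u \<longleftrightarrow> degree (num u) \<le> 3 \<and> degree (den u) \<le> 2 \<and> den u \<noteq> 0"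

definition node_arg :: "'i node \<Rightarrow> 'i set \<Rightarrow> ('i \<Rightarrow> real) \<Rightarrow> real"
  where "node_arg u I v = bias u + (\<Sum>i\<in>I. weight u i * v i)"

definition node_out :: "'i node \<Rightarrow> 'i set \<Rightarrow> ('i \<Rightarrow> real) \<Rightarrow> real"
  where "node_out u I v = poly (num u) (node_arg u I v) / poly (den u) (node_arg u I v)"

definition node_defined :: "'i node \<Rightarrow> 'i set \<Rightarrow> ('i \<Rightarrow> real) \<Rightarrow> bool"
  where "node_defined u I v \<longleftrightarrow> poly (den u) (node_arg u I v) \<noteq> 0"

text \<open>Nodes of the first layer read the input coordinates. Nodes of later layers read the list of
  the outputs of all earlier layers, and weights are indexed by the positions in that list; weights
  at positions beyond its length are irrelevant.\<close>

datatype 'd network =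
  Network (first_layer: "'d node list") (later_layers: "nat node list list")
    (out_weight: "nat \<Rightarrow> real") (out_bias: real)

definition layer_out :: "nat node list \<Rightarrow> real list \<Rightarrow> real list"
  where "layer_out L v = map (\<lambda>u. node_out u {..<length v} ((!) v)) L"

primrec layers_out :: "nat node list list \<Rightarrow> real list \<Rightarrow> real list"
  where
    "layers_out [] v = v"
  | "layers_out (L # Ls) v = layers_out Ls (v @ layer_out L v)"

primrec layers_defined :: "nat node list list \<Rightarrow> real list \<Rightarrow> bool"
  where
    "layers_defined [] v \<longleftrightarrow> True"
  | "layers_defined (L # Ls) v \<longleftrightarrow>
      (\<forall>u\<in>set L. node_defined u {..<length v} ((!) v)) \<and> layers_defined Ls (v @ layer_out L v)"

definition first_out :: "'d::finite network \<Rightarrow> real^'d \<Rightarrow> real list"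
  where "first_out N x = map (\<lambda>u. node_out u UNIV (($) x)) (first_layer N)"

definition node_outputs :: "'d::finite network \<Rightarrow> real^'d \<Rightarrow> real list"
  where "node_outputs N x = layers_out (later_layers N) (first_out N x)"

definition network_fun :: "'d::finite network \<Rightarrow> real^'d \<Rightarrow> real"
  where "network_fun N x =
    (let v = node_outputs N x in out_bias N + (\<Sum>j<length v. out_weight N j * v ! j))"

text \<open>No denominator vanishes while the network is evaluated at a point of the cube, so the
  convention \<open>a / 0 = 0\<close> plays no role there.\<close>

definition defined_on_cube :: "'d::finite network \<Rightarrow> bool"
  where "defined_on_cube N \<longleftrightarrow>
    (\<forall>x\<in>unit_cube. (\<forall>u\<in>set (first_layer N). node_defined u UNIV (($) x)) \<and>
      layers_defined (later_layers N) (first_out N x))"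

definition rational_network :: "'d::finite network \<Rightarrow> bool"
  where "rational_network N \<longleftrightarrow>
    (\<forall>u\<in>set (first_layer N). rational_node u) \<and>
    (\<forall>L\<in>set (later_layers N). \<forall>u\<in>set L. rational_node u) \<and>
    defined_on_cube N"

definition network_size :: "'d network \<Rightarrow> nat"
  where "network_size N = length (first_layer N) + sum_list (map length (later_layers N))"

definition network_depth :: "'d network \<Rightarrow> nat"
  where "network_depth N = 1 + length (later_layers N)"

end

theory Submission
  imports Defs "HOL-Real_Asymp.Real_Asymp"
begin

text \<open>
  Rational activations compute products and quotients exactly, so one can use the Shepard
  weights \<open>w\<^sub>m(x) = (1 + \<bar>N x - m\<bar>\<^sup>2) ^ (- K)\<close>, with \<open>m\<close> ranging over the integer grid \<open>{0..N} ^ d\<close>, instead of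
  a compactly supported partition of unity. If \<open>P\<^sub>m\<close> is a Taylor polynomial of \<open>f\<close> at \<open>m / N\<close>, then
  \<open>f - P\<^sub>m\<close> is at most \<open>\<bar>x - m / N\<bar> ^ n\<close> on the whole cube, and for large \<open>K\<close> the weights decay fast enough
  for \<open>(\<Sum>m. w\<^sub>m P\<^sub>m) / (\<Sum>m. w\<^sub>m)\<close> to approximate \<open>f\<close> up to \<open>C / N ^ n\<close>. As the coefficients of the \<open>P\<^sub>m\<close>
  enter linearly, the numerator is a combination of boundedly many products of a monomial with a
  linear combination of the weights. The resulting network has \<open>O(N ^ d)\<close> nodes and bounded depth.

  The Taylor polynomials are those of a mollification of \<open>f\<close>. Testing the weak derivatives with the
  mollifier bounds the derivatives of the mollification by 1. In order 1 this makes the mollifications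
  equi-Lipschitz; they converge to \<open>f\<close> at its Lebesgue points, so \<open>f\<close> has a Lipschitz representative,
  which they approximate uniformly.
\<close>

section \<open>A smooth bump function\<close>

text \<open>The weights must beat the growth of |x - m/N|^n and stay summable over the grid
  uniformly in \<open>N\<close>. Polynomial decay of an order depending only on \<open>d\<close> and
  \<open>n\<close> does both, so \<open>K\<close> is a constant, and with \<open>K = 2 ^ q\<close> a
  weight costs one inversion and \<open>q\<close> squarings. This is why the depth stays bounded; a
  bounded quantity is in particular O(ln (ln (1 / \<epsilon>))). A Taylor formula needs a
  differentiable function, while the weak derivatives of \<open>f\<close> are only tested against
  functions supported inside the open cube. The estimates for the mollification have constants
  independent of its scale \<delta>, so \<delta> may be chosen after \<epsilon> and as small as
  desired: it influences the values of the network weights, never the number of nodes. Close to the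
  boundary the kernel is no admissible test function; a slight contraction of the cube removes this
  obstacle, and the Lipschitz continuity of the representative pays for the displacement.\<close>

lemma exp_neg_inverse_le:
  fixes s :: real
  assumes "s > 0"
  shows "exp (- 1 / s) \<le> fact k * s ^ k"
proof -
  have "(1 / s) ^ k / fact k \<le> exp (1 / s)"
  proof -
    have "(\<lambda>n. (1/s) ^ n /\<^sub>R fact n) sums exp (1/s)" by (rule exp_converges)
    then have *: "(\<lambda>n. (1/s) ^ n / fact n) sums exp (1/s)"
      by (simp add: divide_inverse mult.commute)
    have "sum (\<lambda>n. (1/s) ^ n / fact n) {k} \<le> (\<Sum>n. (1/s) ^ n / fact n)"
      by (rule sum_le_suminf) (use * assms in \<open>auto simp: sums_iff\<close>)
    then show ?thesis using * by (simp add: sums_iff)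
  qed
  then have "inverse (exp (1/s)) \<le> inverse ((1 / s) ^ k / fact k)"
    using assms by (intro le_imp_inverse_le) auto
  then show ?thesis
    using assms by (simp add: exp_minus power_divide divide_simps mult.commute)
qed

text \<open>At \<open>t = a\<close> the bound forces \<open>f a = 0\<close>, and the difference
  quotient is then at most \<open>C * \<bar>h\<bar>\<close>. It serves twice: to glue the bump
  function at the endpoints of its support, and to differentiate under the integral sign, where the
  quadratic bound comes from a second derivative.\<close>

lemma DERIV_zero_if_quadratic_bound:
  fixes f :: "real \<Rightarrow> real"
  assumes bound: "\<And>t. \<bar>f t\<bar> \<le> C * (t - a)\<^sup>2"
  shows "(f has_real_derivative 0) (at a)"
proof -
  have fa: "f a = 0" using bound[of a] by simp
  have "((\<lambda>h. (f (a + h) - f a) / h) \<longlongrightarrow> 0) (at 0)"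
  proof (rule Lim_null_comparison)
    show "\<forall>\<^sub>F h in at 0. norm ((f (a + h) - f a) / h) \<le> C * \<bar>h\<bar>"
    proof (rule eventually_at_filter[THEN iffD2], rule always_eventually, intro allI impI)
      fix h :: real assume "h \<noteq> 0"
      have "\<bar>f (a + h)\<bar> \<le> C * \<bar>h\<bar> * \<bar>h\<bar>"
        using bound[of "a + h"] by (simp add: power2_eq_square mult.assoc)
      then show "norm ((f (a + h) - f a) / h) \<le> C * \<bar>h\<bar>"
        using \<open>h \<noteq> 0\<close> fa by (simp add: pos_divide_le_eq)
    qed
    show "((\<lambda>h. C * \<bar>h\<bar>) \<longlongrightarrow> 0) (at 0)"
      by (auto intro!: tendsto_eq_intros)
  qed
  then show ?thesis by (simp add: DERIV_def)
qed

text \<open>With \<open>s = t * (1 - t)\<close>, the functions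
  \<open>p / s ^ m * exp (- 1 / s)\<close>, extended by 0, form a family closed under
  differentiation. Smoothness thus reduces to one derivative computation for arbitrary
  \<open>p\<close> and \<open>m\<close>.\<close>

definition bump_fun :: "real poly \<Rightarrow> nat \<Rightarrow> real \<Rightarrow> real"
  where "bump_fun p m t =
    (if 0 < t \<and> t < 1 then poly p t / (t * (1 - t)) ^ m * exp (- 1 / (t * (1 - t))) else 0)"

text \<open>The exponential absorbs the pole: \<open>exp (- 1 / s)\<close> is at most
  \<open>fact (m + 2) * s ^ (m + 2)\<close>, which leaves a factor \<open>s\<^sup>2\<close>, and on
  (0, 1) the quantity \<open>s\<close> is at most \<open>t\<close> and at most
  \<open>1 - t\<close>.\<close>

lemma bump_fun_quadratic_bound:
  obtains C where "\<And>t. \<bar>bump_fun p m t\<bar> \<le> C * (t - 0)\<^sup>2" "\<And>t. \<bar>bump_fun p m t\<bar> \<le> C * (t - 1)\<^sup>2"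
proof -
  have "bounded (poly p ` {0..1})"
    by (intro compact_imp_bounded compact_continuous_image) (auto intro!: continuous_intros)
  then obtain M where M: "M > 0" "\<And>t. 0 \<le> t \<Longrightarrow> t \<le> 1 \<Longrightarrow> \<bar>poly p t\<bar> \<le> M"
    by (auto simp: bounded_pos)
  define C where "C = M * fact (m + 2)"
  have C: "C > 0" using M by (simp add: C_def)
  have main: "\<bar>bump_fun p m t\<bar> \<le> C * (t * (1 - t))\<^sup>2" for t
  proof (cases "0 < t \<and> t < 1")
    case True
    define s where "s = t * (1 - t)"
    have s: "s > 0" using True by (simp add: s_def)
    have "\<bar>bump_fun p m t\<bar> = \<bar>poly p t\<bar> * (exp (- 1 / s) / s ^ m)"
      using True s by (simp add: bump_fun_def s_def abs_mult)
    also have "\<dots> \<le> M * (fact (m + 2) * s ^ (m + 2) / s ^ m)"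
      using M True s by (intro mult_mono divide_right_mono exp_neg_inverse_le) auto
    also have "\<dots> = C * s\<^sup>2" using s by (simp add: C_def power_add power2_eq_square)
    finally show ?thesis by (simp add: s_def)
  next
    case False
    then show ?thesis using C by (auto simp: bump_fun_def)
  qed
  show thesis
  proof (rule that[of C])
    fix t
    show "\<bar>bump_fun p m t\<bar> \<le> C * (t - 0)\<^sup>2"
    proof (cases "0 < t \<and> t < 1")
      case True
      then have "(t * (1 - t))\<^sup>2 \<le> (t - 0)\<^sup>2"
        by (intro power_mono) (auto intro: mult_left_le)
      then show ?thesis using main[of t] C by (smt (verit) mult_left_mono)
    qed (use C in \<open>auto simp: bump_fun_def\<close>)
    show "\<bar>bump_fun p m t\<bar> \<le> C * (t - 1)\<^sup>2"
    proof (cases "0 < t \<and> t < 1")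
      case True
      then have "(t * (1 - t))\<^sup>2 \<le> (1 - t)\<^sup>2"
        by (intro power_mono) (auto simp: mult_le_cancel_right1)
      then show ?thesis using main[of t] C
        by (smt (verit) mult_left_mono power2_commute)
    qed (use C in \<open>auto simp: bump_fun_def\<close>)
  qed
qed

text \<open>The numerator of the derivative of \<open>p / s ^ m * exp (- 1 / s)\<close> over the denominator
  \<open>s ^ (m + 2)\<close>, where \<open>s = t * (1 - t)\<close> has derivative \<open>1 - 2 * t\<close>.\<close>

definition bump_poly :: "real poly \<Rightarrow> nat \<Rightarrow> real poly"
  where "bump_poly p m = pderiv p * [:0, 1, -1:]\<^sup>2 - smult (real m) (p * [:1, -2:] * [:0, 1, -1:])
     + p * [:1, -2:]"

lemma quotient_times_exp_has_derivative:
  fixes S :: "real \<Rightarrow> real"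
  assumes S: "(S has_real_derivative D) (at t)" and "S t \<noteq> 0"
  shows "((\<lambda>t. poly p t / S t ^ m * exp (- 1 / S t)) has_real_derivative
       ((poly (pderiv p) t * S t ^ m - poly p t * (real m * S t ^ (m - 1) * D)) / (S t ^ m * S t ^ m))
         * exp (- 1 / S t) + poly p t / S t ^ m * (exp (- 1 / S t) * (D / (S t)\<^sup>2))) (at t)"
proof -
  have 1: "((\<lambda>t. S t ^ m) has_real_derivative real m * S t ^ (m - 1) * D) (at t)"
    using DERIV_power[OF S, of m] by (simp add: mult_ac)
  have 2: "((\<lambda>t. poly p t / S t ^ m) has_real_derivative
      (poly (pderiv p) t * S t ^ m - poly p t * (real m * S t ^ (m - 1) * D)) / (S t ^ m * S t ^ m)) (at t)"
    by (rule DERIV_divide[OF poly_DERIV 1]) (use assms in simp)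
  have 3: "((\<lambda>t. - 1 / S t) has_real_derivative D / (S t)\<^sup>2) (at t)"
    using DERIV_divide[OF DERIV_const S assms(2), of "-1"] by (simp add: power2_eq_square)
  have 4: "((\<lambda>t. exp (- 1 / S t)) has_real_derivative exp (- 1 / S t) * (D / (S t)\<^sup>2)) (at t)"
    by (rule DERIV_chain2[OF DERIV_exp 3])
  show ?thesis using DERIV_mult'[OF 2 4] by (simp add: add.commute)
qed

lemma bump_fun_has_derivative:
  "(bump_fun p m has_real_derivative bump_fun (bump_poly p m) (m + 2) t) (at t)"
proof -
  obtain C where C: "\<And>t. \<bar>bump_fun p m t\<bar> \<le> C * (t - 0)\<^sup>2" "\<And>t. \<bar>bump_fun p m t\<bar> \<le> C * (t - 1)\<^sup>2"
    by (rule bump_fun_quadratic_bound[of p m]) blast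
  consider "t = 0" | "t = 1" | "0 < t \<and> t < 1" | "t < 0" | "t > 1" by linarith
  then show ?thesis
  proof cases
    case 1
    then have "bump_fun (bump_poly p m) (m + 2) t = 0" by (simp add: bump_fun_def)
    then show ?thesis using DERIV_zero_if_quadratic_bound[OF C(1)] 1 by simp
  next
    case 2
    then have "bump_fun (bump_poly p m) (m + 2) t = 0" by (simp add: bump_fun_def)
    then show ?thesis using DERIV_zero_if_quadratic_bound[OF C(2)] 2 by simp
  next
    case 3
    define s where "s = t * (1 - t)"
    have s: "s > 0" using 3 by (simp add: s_def)
    have t0: "t \<noteq> 0" "1 - t \<noteq> 0" using 3 by auto
    have ds: "((\<lambda>t::real. t * (1 - t)) has_real_derivative (1 - 2 * t)) (at t)"
      by (auto intro!: derivative_eq_intros)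
    have "((\<lambda>t. poly p t / (t * (1 - t)) ^ m * exp (- 1 / (t * (1 - t)))) has_real_derivative
       ((poly (pderiv p) t * s ^ m - poly p t * (real m * s ^ (m - 1) * (1 - 2 * t))) / (s ^ m * s ^ m))
         * exp (- 1 / s) + poly p t / s ^ m * (exp (- 1 / s) * ((1 - 2 * t) / s\<^sup>2))) (at t)"
      unfolding s_def by (rule quotient_times_exp_has_derivative[OF ds]) (use t0 in simp)
    also have "((poly (pderiv p) t * s ^ m - poly p t * (real m * s ^ (m - 1) * (1 - 2 * t))) / (s ^ m * s ^ m))
         * exp (- 1 / s) + poly p t / s ^ m * (exp (- 1 / s) * ((1 - 2 * t) / s\<^sup>2))
        = bump_fun (bump_poly p m) (m + 2) t"
    proof -
      have "bump_fun (bump_poly p m) (m + 2) t =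
        (poly (pderiv p) t * s\<^sup>2 - real m * poly p t * (1 - 2 * t) * s + poly p t * (1 - 2 * t)) / s ^ (m + 2)
          * exp (- 1 / s)"
        using 3 by (simp add: bump_fun_def bump_poly_def s_def algebra_simps power2_eq_square)
      \<comment> \<open>The case distinction on \<open>m\<close> is due to the truncated
        \<open>m - 1\<close>; for \<open>m = 0\<close> the term concerned has the factor
        \<open>real m = 0\<close>.\<close>
      moreover have "(poly (pderiv p) t * s ^ m - poly p t * (real m * s ^ (m - 1) * (1 - 2 * t))) / (s ^ m * s ^ m)
         = (poly (pderiv p) t * s\<^sup>2 - real m * poly p t * (1 - 2 * t) * s) / s ^ (m + 2)"
        using s by (cases m) (simp_all add: field_simps power_add power2_eq_square)
      moreover have "poly p t / s ^ m * (exp (- 1 / s) * ((1 - 2 * t) / s\<^sup>2))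
          = (poly p t * (1 - 2 * t)) / s ^ (m + 2) * exp (- 1 / s)"
        by (simp add: power_add power2_eq_square mult_ac)
      ultimately show ?thesis
        by (simp only: add_divide_distrib ring_distribs)
    qed
    finally show ?thesis
      by (rule has_field_derivative_transform_within_open[where S = "{0<..<1}"])
        (use 3 in \<open>auto simp: bump_fun_def\<close>)
  next
    case 4
    have "((\<lambda>_. 0) has_real_derivative 0) (at t)" by simp
    then have "(bump_fun p m has_real_derivative 0) (at t)"
      by (rule has_field_derivative_transform_within_open[where S = "{..<0}"])
        (use 4 in \<open>auto simp: bump_fun_def\<close>)
    moreover have "bump_fun (bump_poly p m) (m + 2) t = 0" using 4 by (simp add: bump_fun_def)
    ultimately show ?thesis by simp
  next
    case 5
    have "((\<lambda>_. 0) has_real_derivative 0) (at t)" by simp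
    then have "(bump_fun p m has_real_derivative 0) (at t)"
      by (rule has_field_derivative_transform_within_open[where S = "{1<..}"])
        (use 5 in \<open>auto simp: bump_fun_def\<close>)
    moreover have "bump_fun (bump_poly p m) (m + 2) t = 0" using 5 by (simp add: bump_fun_def)
    ultimately show ?thesis by simp
  qed
qed

text \<open>The numerators of the successive derivatives of exp(-1 / (t (1 - t))). Each
  differentiation raises the exponent of the denominator by 2, which is why the k-th one belongs to
  the exponent \<open>2 * k\<close>.\<close>

fun bump_poly_iter :: "nat \<Rightarrow> real poly"
  where "bump_poly_iter 0 = 1"
  | "bump_poly_iter (Suc k) = bump_poly (bump_poly_iter k) (2 * k)"

definition bump :: "nat \<Rightarrow> real \<Rightarrow> real"
  where "bump k = bump_fun (bump_poly_iter k) (2 * k)"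

lemma bump_has_derivative: "(bump k has_real_derivative bump (Suc k) t) (at t)"
  using bump_fun_has_derivative[of "bump_poly_iter k" "2 * k" t] by (simp add: bump_def)

lemma continuous_on_bump: "continuous_on S (bump k)"
  by (meson DERIV_isCont bump_has_derivative continuous_at_imp_continuous_on)

lemma bump_eq_0: "\<not> (0 < t \<and> t < 1) \<Longrightarrow> bump k t = 0"
  by (auto simp: bump_def bump_fun_def)

lemma bump_0_pos: "0 < t \<Longrightarrow> t < 1 \<Longrightarrow> bump 0 t > 0"
  by (auto simp: bump_def bump_fun_def)

lemma bump_0_nonneg: "bump 0 t \<ge> 0"
  by (auto simp: bump_def bump_fun_def)

lemma bump_bounded:
  obtains M where "M > 0" "\<And>t. \<bar>bump k t\<bar> \<le> M"
proof -
  have "bounded (bump k ` {0..1})"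
    by (intro compact_imp_bounded compact_continuous_image continuous_on_bump) auto
  then obtain M where M: "M > 0" "\<And>t. 0 \<le> t \<Longrightarrow> t \<le> 1 \<Longrightarrow> \<bar>bump k t\<bar> \<le> M"
    by (auto simp: bounded_pos)
  have "\<bar>bump k t\<bar> \<le> M" for t
    using M bump_eq_0[of t k] by (cases "0 < t \<and> t < 1") auto
  with M(1) show thesis by (rule that)
qed

section \<open>Shepard weights\<close>

text \<open>This norm fits Taylor remainders: the absolute values of all monomials of degree
  \<open>k\<close>, indexed by lists, sum to exactly the \<open>k\<close>-th power of it. For
  \<open>k = 1\<close> it is the norm in which a function with first partial derivatives bounded by
  1 has Lipschitz constant 1.\<close>

definition l1 :: "real^'d::finite \<Rightarrow> real"
  where "l1 x = (\<Sum>i\<in>UNIV. \<bar>x $ i\<bar>)"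

text \<open>The argument will be \<open>real N *\<^sub>R x - m\<close>, so distances are measured in
  units of the grid width and the bounds on sums of weights do not depend on \<open>N\<close>. The
  base of the power is the inverse of a polynomial in \<open>z\<close>.\<close>

definition shepard_weight :: "nat \<Rightarrow> real^'d::finite \<Rightarrow> real"
  where "shepard_weight K z = (1 / (1 + (\<Sum>i\<in>UNIV. (z $ i)\<^sup>2))) ^ K"

definition grid :: "nat \<Rightarrow> (real^'d::finite) set"
  where "grid N = {m. \<forall>i. m $ i \<in> real ` {..N}}"

lemma grid_eq_image: "grid N = (\<lambda>h. \<chi> i. real (h i)) ` (UNIV \<rightarrow>\<^sub>E {..N})"
proof (intro set_eqI iffI)
  fix m :: "real^'d" assume "m \<in> grid N"
  then have "\<forall>i. \<exists>k. m $ i = real k \<and> k \<le> N" unfolding grid_def by blast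
  then obtain h where h: "\<And>i. m $ i = real (h i)" "\<And>i. h i \<le> N" by metis
  then have "m = (\<chi> i. real (h i))" "h \<in> UNIV \<rightarrow>\<^sub>E {..N}" by (auto simp: vec_eq_iff)
  then show "m \<in> (\<lambda>h. \<chi> i. real (h i)) ` (UNIV \<rightarrow>\<^sub>E {..N})" by blast
qed (auto simp: grid_def PiE_def Pi_def)

lemma inj_grid: "inj_on (\<lambda>h. (\<chi> i. real (h i)) :: real^'d::finite) A"
  by (auto simp: inj_on_def vec_eq_iff)

lemma finite_grid: "finite (grid N :: (real^'d::finite) set)"
  unfolding grid_eq_image by (intro finite_imageI finite_PiE) auto

lemma card_grid: "card (grid N :: (real^'d::finite) set) = (N + 1) ^ CARD('d)"
  unfolding grid_eq_image by (simp add: card_image[OF inj_grid] card_PiE)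

text \<open>The subtracted term is a telescoping remainder that makes the induction work, since the
  new summand is at most 2 / (M + 1) - 2 / (M + 2). What matters later is the uniform bound
  3.\<close>

lemma sum_inverse_Suc_square_le: "(\<Sum>k\<le>M. 1 / (1 + (real k)\<^sup>2)) \<le> 3 - 2 / (real M + 1)"
proof (induction M)
  case (Suc M)
  have "1 / (1 + (real M + 1)\<^sup>2) \<le> 2 / ((real M + 1) * (real M + 2))"
  proof -
    have "(real M + 1) * (real M + 2) \<le> 2 * (1 + (real M + 1)\<^sup>2)"
      by (simp add: power2_eq_square algebra_simps)
    moreover have "0 < 1 + (real M + 1)\<^sup>2" by (simp add: add_pos_nonneg)
    ultimately show ?thesis by (simp add: divide_le_eq le_divide_eq mult_ac)
  qed
  also have "\<dots> = 2 / (real M + 1) - 2 / (real M + 2)"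
    by (simp add: divide_simps)
  finally show ?case using Suc by (simp add: add.commute)
qed simp

text \<open>Cut at the integer part of \<open>t\<close>: on either side the distances from
  \<open>t\<close> to the integers are at least 0, 1, 2, ..., so each half is at most 3.\<close>

lemma sum_translated_inverse_square_le:
  fixes t :: real
  assumes "t \<ge> 0"
  shows "(\<Sum>k\<le>N. 1 / (1 + (t - real k)\<^sup>2)) \<le> 6"
proof -
  define q where "q = nat \<lfloor>t\<rfloor>"
  have q: "real q \<le> t" "t < real q + 1" using assms unfolding q_def by linarith+
  have bound: "(\<Sum>k\<le>M. 1 / (1 + (real k)\<^sup>2)) \<le> 3" for M
    by (rule order.trans[OF sum_inverse_Suc_square_le]) simp
  \<comment> \<open>\<open>t\<close> may lie beyond \<open>N\<close>. The enlarged index set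
    contains \<open>{..N}\<close> in every case and always has both halves.\<close>
  have "(\<Sum>k\<le>N. 1 / (1 + (t - real k)\<^sup>2)) \<le> (\<Sum>k\<in>{..q} \<union> {Suc q..q + Suc N}. 1 / (1 + (t - real k)\<^sup>2))"
    by (rule sum_mono2) (auto simp: add_nonneg_pos intro!: divide_nonneg_nonneg add_nonneg_nonneg)
  also have "\<dots> = (\<Sum>k\<le>q. 1 / (1 + (t - real k)\<^sup>2)) + (\<Sum>k\<in>{Suc q..q + Suc N}. 1 / (1 + (t - real k)\<^sup>2))"
    by (rule sum.union_disjoint) auto
  also have "(\<Sum>k\<le>q. 1 / (1 + (t - real k)\<^sup>2)) = (\<Sum>k\<le>q. 1 / (1 + (t - real (q - k))\<^sup>2))"
    by (rule sum.reindex_bij_witness[of _ "\<lambda>k. q - k" "\<lambda>k. q - k"]) auto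
  also have "\<dots> \<le> (\<Sum>k\<le>q. 1 / (1 + (real k)\<^sup>2))"
    by (intro sum_mono divide_left_mono add_left_mono power_mono mult_pos_pos add_pos_nonneg)
      (use q in \<open>auto simp: of_nat_diff\<close>)
  also have "(\<Sum>k\<in>{Suc q..q + Suc N}. 1 / (1 + (t - real k)\<^sup>2))
      = (\<Sum>k\<le>N. 1 / (1 + (t - real (k + Suc q))\<^sup>2))"
    by (rule sum.reindex_bij_witness[of _ "\<lambda>k. k + Suc q" "\<lambda>k. k - Suc q"]) auto
  also have "\<dots> = (\<Sum>k\<le>N. 1 / (1 + (real (k + Suc q) - t)\<^sup>2))"
    by (simp add: power2_commute)
  also have "\<dots> \<le> (\<Sum>k\<le>N. 1 / (1 + (real k)\<^sup>2))"
    by (intro sum_mono divide_left_mono add_left_mono power_mono mult_pos_pos add_pos_nonneg)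
      (use q in \<open>auto simp: of_nat_diff\<close>)
  finally show ?thesis using bound[of q] bound[of N] by linarith
qed

lemma one_plus_sum_le_prod:
  fixes a :: "'a \<Rightarrow> real"
  assumes "finite A" "\<And>i. i \<in> A \<Longrightarrow> a i \<ge> 0"
  shows "1 + sum a A \<le> (\<Prod>i\<in>A. 1 + a i)"
  using assms
proof (induction A rule: finite_induct)
  case (insert i A)
  have "1 + sum a (insert i A) \<le> (1 + a i) * (1 + sum a A)"
    using insert by (simp add: algebra_simps sum_nonneg)
  also have "\<dots> \<le> (1 + a i) * (\<Prod>i\<in>A. 1 + a i)"
    using insert by (intro mult_left_mono) auto
  finally show ?case using insert by simp
qed simp

lemma one_plus_abs_le: "1 + \<bar>t\<bar> \<le> 2 * (1 + t\<^sup>2)" for t :: real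
proof -
  have "0 \<le> (\<bar>t\<bar> - 1)\<^sup>2" by simp
  then have "2 * \<bar>t\<bar> \<le> 1 + t\<^sup>2" by (simp add: power2_diff)
  moreover have "0 \<le> t\<^sup>2" by simp
  ultimately show ?thesis by argo
qed

text \<open>Let y be 1 plus the squared Euclidean norm of \<open>z\<close>, and P the product of the
  factors \<open>1 + (z $ i)\<^sup>2\<close>. Then \<open>l1 z ^ n\<close> is at most a constant
  times P^n, and P is at most y^d. Hence \<open>K \<ge> CARD('d) * (n + 1)\<close> gives y^(-K)
  \<le> P^(-n-1), and one factor 1 / P survives. As a product over coordinates it can be summed over
  the grid one coordinate at a time.\<close>

lemma shepard_weight_times_power_le:
  fixes z :: "real^'d::finite"
  assumes K: "K \<ge> CARD('d) * (n + 1)"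
  shows "shepard_weight K z * l1 z ^ n \<le> 2 ^ (n * CARD('d)) * (\<Prod>i\<in>UNIV. 1 / (1 + (z $ i)\<^sup>2))"
proof -
  define y where "y = 1 + (\<Sum>i\<in>UNIV. (z $ i)\<^sup>2)"
  have y: "y \<ge> 1" unfolding y_def by (simp add: sum_nonneg)
  have yi: "1 + (z $ i)\<^sup>2 \<le> y" for i
    unfolding y_def by (auto intro!: member_le_sum)
  have pos: "1 + (z $ i)\<^sup>2 > 0" for i by (simp add: add_pos_nonneg)
  have "l1 z ^ n \<le> (\<Prod>i\<in>UNIV. 1 + \<bar>z $ i\<bar>) ^ n"
    unfolding l1_def using one_plus_sum_le_prod[of UNIV "\<lambda>i. \<bar>z $ i\<bar>"]
    by (intro power_mono) (auto intro: sum_nonneg)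
  also have "\<dots> \<le> (\<Prod>i\<in>UNIV. 2 * (1 + (z $ i)\<^sup>2)) ^ n"
  proof (intro power_mono prod_mono conjI)
    show "1 + \<bar>z $ i\<bar> \<le> 2 * (1 + (z $ i)\<^sup>2)" for i by (rule one_plus_abs_le)
  qed (auto intro: prod_nonneg)
  also have "\<dots> = 2 ^ (n * CARD('d)) * (\<Prod>i\<in>UNIV. 1 + (z $ i)\<^sup>2) ^ n"
    by (simp only: prod.distrib power_mult_distrib prod_constant power_mult mult.commute[of n])
  finally have l: "l1 z ^ n \<le> 2 ^ (n * CARD('d)) * (\<Prod>i\<in>UNIV. 1 + (z $ i)\<^sup>2) ^ n" .
  have P: "(\<Prod>i\<in>UNIV. 1 + (z $ i)\<^sup>2) > 0" using pos by (intro prod_pos) auto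
  have "(\<Prod>i\<in>UNIV. 1 + (z $ i)\<^sup>2) ^ (n + 1) \<le> (\<Prod>i\<in>(UNIV::'d set). y) ^ (n + 1)"
    using yi pos by (intro power_mono prod_mono prod_nonneg) (auto intro: less_imp_le)
  also have "\<dots> = y ^ (CARD('d) * (n + 1))" by (simp only: prod_constant power_mult)
  also have "\<dots> \<le> y ^ K" using K y by (rule power_increasing)
  finally have "1 / y ^ K \<le> 1 / (\<Prod>i\<in>UNIV. 1 + (z $ i)\<^sup>2) ^ (n + 1)"
    using pos by (intro divide_left_mono) (use y in \<open>auto intro!: mult_pos_pos prod_pos zero_less_power\<close>)
  then have "shepard_weight K z * l1 z ^ n \<le>
     1 / (\<Prod>i\<in>UNIV. 1 + (z $ i)\<^sup>2) ^ (n + 1) * (2 ^ (n * CARD('d)) * (\<Prod>i\<in>UNIV. 1 + (z $ i)\<^sup>2) ^ n)"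
    unfolding shepard_weight_def using l pos y
    by (intro mult_mono) (auto simp: power_one_over y_def l1_def P less_imp_le simp del: power_Suc
      intro!: sum_nonneg)
  also have "\<dots> = 2 ^ (n * CARD('d)) * (1 / (\<Prod>i\<in>UNIV. 1 + (z $ i)\<^sup>2))"
    using P by (simp add: field_simps)
  also have "1 / (\<Prod>i\<in>UNIV. 1 + (z $ i)\<^sup>2) = (\<Prod>i\<in>UNIV. 1 / (1 + (z $ i)\<^sup>2))"
    by (simp add: prod_dividef)
  finally show ?thesis .
qed

lemma shepard_weight_pos: "shepard_weight K z > 0"
  unfolding shepard_weight_def by (intro zero_less_power divide_pos_pos add_pos_nonneg sum_nonneg) auto

lemma sum_shepard_weight_pos: "(\<Sum>m\<in>grid N. shepard_weight K (z - m :: real^'d::finite)) > 0"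
  using finite_grid shepard_weight_pos
  by (intro sum_pos) (auto simp: grid_eq_image PiE_eq_empty_iff)

text \<open>The left-hand side is at most \<open>2 ^ (n * CARD('d)) * 6 ^ CARD('d)\<close>, because
  the sum of products over the grid is a product of one-dimensional sums. The sum of the weights is
  bounded below by a single one, that of the lower corner \<open>m0\<close> of the grid cell of
  \<open>z\<close>: its squared distance to \<open>z\<close> is at most the dimension, whence the
  factor \<open>(1 + real CARD('d)) ^ K\<close>.\<close>

lemma sum_shepard_weight_times_power_le:
  fixes z :: "real^'d::finite"
  assumes K: "K \<ge> CARD('d) * (n + 1)" and z: "\<And>i. 0 \<le> z $ i" "\<And>i. z $ i \<le> real N"
  shows "(\<Sum>m\<in>grid N. shepard_weight K (z - m) * l1 (z - m) ^ n) \<le>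
    2 ^ (n * CARD('d)) * 6 ^ CARD('d) * (1 + real CARD('d)) ^ K * (\<Sum>m\<in>grid N. shepard_weight K (z - m))"
proof -
  have "(\<Sum>m\<in>grid N. shepard_weight K (z - m) * l1 (z - m) ^ n)
      \<le> (\<Sum>m\<in>grid N. 2 ^ (n * CARD('d)) * (\<Prod>i\<in>UNIV. 1 / (1 + ((z - m) $ i)\<^sup>2)))"
    by (intro sum_mono shepard_weight_times_power_le K)
  also have "\<dots> = 2 ^ (n * CARD('d)) * (\<Sum>h\<in>UNIV \<rightarrow>\<^sub>E {..N}. \<Prod>i\<in>UNIV. 1 / (1 + (z $ i - real (h i))\<^sup>2))"
    unfolding grid_eq_image sum_distrib_left by (subst sum.reindex[OF inj_grid]) simp
  also have "(\<Sum>h\<in>UNIV \<rightarrow>\<^sub>E {..N}. \<Prod>i\<in>UNIV. 1 / (1 + (z $ i - real (h i))\<^sup>2))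
      = (\<Prod>i\<in>UNIV. \<Sum>k\<le>N. 1 / (1 + (z $ i - real k)\<^sup>2))"
    by (rule prod_sum_PiE[symmetric]) auto
  also have "\<dots> \<le> (\<Prod>i\<in>(UNIV::'d set). 6)"
    using z by (intro prod_mono conjI sum_translated_inverse_square_le sum_nonneg divide_nonneg_nonneg add_nonneg_nonneg) auto
  finally have upper: "(\<Sum>m\<in>grid N. shepard_weight K (z - m) * l1 (z - m) ^ n) \<le> 2 ^ (n * CARD('d)) * 6 ^ CARD('d)"
    by simp
  define m0 :: "real^'d" where "m0 = (\<chi> i. real (nat \<lfloor>z $ i\<rfloor>))"
  have m0: "m0 \<in> grid N"
  proof -
    have "nat \<lfloor>z $ i\<rfloor> \<le> N" for i using z[of i] by linarith
    then show ?thesis unfolding grid_def m0_def by (intro CollectI allI) (simp only: vec_lambda_beta, blast)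
  qed
  have "((z - m0) $ i)\<^sup>2 \<le> 1" for i
  proof -
    have "0 \<le> z $ i - m0 $ i" "z $ i - m0 $ i \<le> 1" unfolding m0_def using z(1)[of i] by simp_all linarith+
    then show ?thesis by (simp add: power_le_one)
  qed
  then have "1 + (\<Sum>i\<in>UNIV. ((z - m0) $ i)\<^sup>2) \<le> 1 + real CARD('d)"
    using sum_bounded_above[of UNIV "\<lambda>i. ((z - m0) $ i)\<^sup>2" 1] by simp
  then have "(1 / (1 + real CARD('d))) ^ K \<le> shepard_weight K (z - m0)"
    unfolding shepard_weight_def
    by (intro power_mono divide_left_mono mult_pos_pos add_pos_nonneg sum_nonneg) auto
  also have "\<dots> \<le> (\<Sum>m\<in>grid N. shepard_weight K (z - m))"
    using m0 finite_grid shepard_weight_pos by (intro member_le_sum) (auto intro: less_imp_le)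
  finally have "1 \<le> (1 + real CARD('d)) ^ K * (\<Sum>m\<in>grid N. shepard_weight K (z - m))"
    by (simp add: power_divide divide_simps add_pos_nonneg mult.commute)
  then have "2 ^ (n * CARD('d)) * 6 ^ CARD('d) * 1 \<le> 2 ^ (n * CARD('d)) * 6 ^ CARD('d) * ((1 + real CARD('d)) ^ K * (\<Sum>m\<in>grid N. shepard_weight K (z - m)))"
    by (intro mult_left_mono) auto
  with upper show ?thesis by (simp only: mult.assoc mult_1_right)
qed

text \<open>Lists of indices instead of multi-indices: every monomial occurs once for each ordering
  of its factors, so Taylor's formula holds without multinomial coefficients.\<close>

definition monomial :: "'d list \<Rightarrow> real^'d::finite \<Rightarrow> real"
  where "monomial ks x = (\<Prod>i\<leftarrow>ks. x $ i)"

lemma monomial_Nil: "monomial [] x = 1"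
  and monomial_Cons: "monomial (i # ks) x = x $ i * monomial ks x"
  by (simp_all add: monomial_def)

lemma finite_lists_le: "finite {ks :: 'd::finite list. length ks \<le> k}"
  using finite_lists_length_le[of "UNIV :: 'd set" k] by simp

section \<open>Functions computed by layered networks\<close>

lemma zero_in_unit_cube: "(0::real^'d::finite) \<in> unit_cube"
  by (simp add: mem_box_cart)

text \<open>These are the functions that a node of the next layer, or the output, can form from the
  node outputs \<open>Fs\<close> through its weights and bias; affine combinations therefore cost no
  nodes. Equality is required on the cube only, where networks are evaluated.\<close>

definition aff_span :: "(real^'d::finite \<Rightarrow> real) list \<Rightarrow> (real^'d \<Rightarrow> real) set"
  where "aff_span Fs = {h. \<exists>b w. \<forall>x\<in>unit_cube. h x = b + (\<Sum>j<length Fs. w j * (Fs ! j) x)}"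

lemma aff_span_const: "(\<lambda>_. c) \<in> aff_span Fs"
  unfolding aff_span_def by (intro CollectI exI[of _ c] exI[of _ "\<lambda>_. 0"]) simp

lemma aff_span_nth: "j < length Fs \<Longrightarrow> Fs ! j \<in> aff_span Fs"
  unfolding aff_span_def
  by (intro CollectI exI[of _ 0] exI[of _ "\<lambda>i. if i = j then 1 else 0"]) (simp add: if_distrib[of "\<lambda>x. x * _"] cong: if_cong)

lemma aff_span_mem: "F \<in> set Fs \<Longrightarrow> F \<in> aff_span Fs"
  by (metis aff_span_nth in_set_conv_nth)

lemma aff_span_add:
  assumes "g \<in> aff_span Fs" "h \<in> aff_span Fs"
  shows "(\<lambda>x. g x + h x) \<in> aff_span Fs"
proof -
  obtain b w b' w' where "\<forall>x\<in>unit_cube. g x = b + (\<Sum>j<length Fs. w j * (Fs ! j) x)"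
    "\<forall>x\<in>unit_cube. h x = b' + (\<Sum>j<length Fs. w' j * (Fs ! j) x)"
    using assms unfolding aff_span_def by blast
  then show ?thesis unfolding aff_span_def
    by (intro CollectI exI[of _ "b + b'"] exI[of _ "\<lambda>j. w j + w' j"]) (simp add: sum.distrib ring_distribs)
qed

lemma aff_span_cmult:
  assumes "g \<in> aff_span Fs"
  shows "(\<lambda>x. c * g x) \<in> aff_span Fs"
proof -
  obtain b w where "\<forall>x\<in>unit_cube. g x = b + (\<Sum>j<length Fs. w j * (Fs ! j) x)"
    using assms unfolding aff_span_def by blast
  then show ?thesis unfolding aff_span_def
    by (intro CollectI exI[of _ "c * b"] exI[of _ "\<lambda>j. c * w j"]) (simp add: sum_distrib_left ring_distribs mult.assoc)
qed

lemma aff_span_diff: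
  assumes "g \<in> aff_span Fs" "h \<in> aff_span Fs"
  shows "(\<lambda>x. g x - h x) \<in> aff_span Fs"
  using aff_span_add[OF assms(1) aff_span_cmult[OF assms(2), of "-1"]] by simp

lemma aff_span_sum:
  assumes "\<And>i. i \<in> I \<Longrightarrow> g i \<in> aff_span Fs"
  shows "(\<lambda>x. \<Sum>i\<in>I. g i x) \<in> aff_span Fs"
  using assms
proof (induction I rule: infinite_finite_induct)
  case (insert i I)
  then show ?case using aff_span_add[of "g i" Fs "\<lambda>x. \<Sum>i\<in>I. g i x"] by simp
qed (auto intro: aff_span_const)

lemma aff_span_cong:
  assumes "g \<in> aff_span Fs" "\<And>x. x \<in> unit_cube \<Longrightarrow> h x = g x"
  shows "h \<in> aff_span Fs"
  using assms unfolding aff_span_def by simp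

lemma aff_span_append: "aff_span Fs \<subseteq> aff_span (Fs @ Gs)"
proof
  fix h assume "h \<in> aff_span Fs"
  then obtain b w where h: "\<forall>x\<in>unit_cube. h x = b + (\<Sum>j<length Fs. w j * (Fs ! j) x)"
    unfolding aff_span_def by blast
  have mem: "(\<lambda>x. b + (\<Sum>j<length Fs. w j * (Fs ! j) x)) \<in> aff_span (Fs @ Gs)"
    by (intro aff_span_add aff_span_const aff_span_sum aff_span_cmult aff_span_mem) auto
  show "h \<in> aff_span (Fs @ Gs)" by (rule aff_span_cong[OF mem]) (use h in blast)
qed

text \<open>The list \<open>Fs\<close> contains the outputs of all nodes, so its length is the size of the network.\<close>

definition layered :: "(real^'d::finite \<Rightarrow> real) list \<Rightarrow> nat \<Rightarrow> bool"
  where "layered Fs t \<longleftrightarrow> (\<exists>(L :: 'd node list) Ls.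
    (\<forall>u\<in>set L. rational_node u) \<and> (\<forall>L\<in>set Ls. \<forall>u\<in>set L. rational_node u) \<and>
    length Fs = length L + sum_list (map length Ls) \<and> t = 1 + length Ls \<and>
    (\<forall>x\<in>unit_cube. (\<forall>u\<in>set L. node_defined u UNIV (($) x)) \<and>
      layers_defined Ls (map (\<lambda>u. node_out u UNIV (($) x)) L) \<and>
      layers_out Ls (map (\<lambda>u. node_out u UNIV (($) x)) L) = map (\<lambda>F. F x) Fs))"

lemma layers_out_snoc:
  "layers_out (Ls @ [L]) v = layers_out Ls v @ layer_out L (layers_out Ls v)"
  by (induction Ls arbitrary: v) auto

lemma layers_defined_snoc:
  "layers_defined (Ls @ [L]) v \<longleftrightarrow> layers_defined Ls v \<and>
    (\<forall>u\<in>set L. node_defined u {..<length (layers_out Ls v)} ((!) (layers_out Ls v)))"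
  by (induction Ls arbitrary: v) auto

text \<open>Later layers cannot read the input, so the first layer passes the coordinates on through
  nodes with the identity as activation.\<close>

lemma layered_coordinates:
  obtains Fs :: "(real^'d::finite \<Rightarrow> real) list"
  where "layered Fs 1" "\<And>i. (\<lambda>x. x $ i) \<in> aff_span Fs"
proof -
  obtain ds :: "'d list" where ds: "set ds = UNIV" using finite_list[OF finite[of UNIV]] by blast
  define node where "node i = Node (\<lambda>j. if j = i then 1 else 0) 0 [:0, 1:] (1 :: real poly)" for i :: 'd
  have arg: "node_arg (node i) UNIV (($) x) = x $ i" for i and x :: "real^'d"
    by (simp add: node_arg_def node_def if_distrib[of "\<lambda>x. x * _"] cong: if_cong)
  have out: "node_out (node i) UNIV (($) x) = x $ i" for i and x :: "real^'d"
    by (simp add: node_out_def arg) (simp add: node_def)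
  have "layered (map (\<lambda>i x. x $ i) ds) 1"
    unfolding layered_def
    by (intro exI[of _ "map node ds"] exI[of _ "[]"])
      (auto simp: out arg rational_node_def node_defined_def, auto simp: node_def)
  moreover have "(\<lambda>x. x $ i) \<in> aff_span (map (\<lambda>i x. x $ i) ds)" for i
    using ds by (intro aff_span_mem) auto
  ultimately show thesis by (rule that)
qed

lemma layered_add_layer:
  fixes Fs :: "(real^'d::finite \<Rightarrow> real) list"
  assumes lay: "layered Fs t" and fin: "finite I"
    and a: "\<And>i. i \<in> I \<Longrightarrow> a i \<in> aff_span Fs"
    and deg: "\<And>i. i \<in> I \<Longrightarrow> degree (p i) \<le> 3" "\<And>i. i \<in> I \<Longrightarrow> degree (q i) \<le> 2"
    and nz: "\<And>i x. i \<in> I \<Longrightarrow> x \<in> unit_cube \<Longrightarrow> poly (q i) (a i x) \<noteq> 0"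
  obtains Fs' where "layered Fs' (Suc t)" "length Fs' = length Fs + card I"
    "aff_span Fs \<subseteq> aff_span Fs'"
    "\<And>i. i \<in> I \<Longrightarrow> (\<lambda>x. poly (p i) (a i x) / poly (q i) (a i x)) \<in> aff_span Fs'"
proof -
  obtain L :: "'d node list" and Ls where
    rat: "\<forall>u\<in>set L. rational_node u" "\<forall>L\<in>set Ls. \<forall>u\<in>set L. rational_node u"
    and len: "length Fs = length L + sum_list (map length Ls)" "t = 1 + length Ls"
    and out: "\<And>x. x \<in> unit_cube \<Longrightarrow> (\<forall>u\<in>set L. node_defined u UNIV (($) x)) \<and>
      layers_defined Ls (map (\<lambda>u. node_out u UNIV (($) x)) L) \<and>
      layers_out Ls (map (\<lambda>u. node_out u UNIV (($) x)) L) = map (\<lambda>F. F x) Fs"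
    using lay unfolding layered_def by blast
  obtain ks where ks: "set ks = I" "distinct ks" using finite_distinct_list[OF fin] by blast
  have "\<forall>i\<in>I. \<exists>b w. \<forall>x\<in>unit_cube. a i x = b + (\<Sum>j<length Fs. w j * (Fs ! j) x)"
    using a unfolding aff_span_def by blast
  then obtain b w where bw: "\<And>i x. i \<in> I \<Longrightarrow> x \<in> unit_cube \<Longrightarrow> a i x = b i + (\<Sum>j<length Fs. w i j * (Fs ! j) x)"
    by metis
  define node where "node i = Node (w i) (b i) (p i) (q i)" for i
  define G where "G i x = poly (p i) (a i x) / poly (q i) (a i x)" for i x
  define Fs' where "Fs' = Fs @ map G ks"
  have arg: "node_arg (node i) {..<length Fs} ((!) (map (\<lambda>F. F x) Fs)) = a i x" if "i \<in> I" "x \<in> unit_cube" for i x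
    using bw[OF that] by (simp add: node_arg_def node_def)
  have "layered Fs' (Suc t)"
    unfolding layered_def
  proof (intro exI conjI ballI)
    fix x :: "real^'d" assume x: "x \<in> unit_cube"
    show "u \<in> set L \<Longrightarrow> node_defined u UNIV (($) x)" for u using out[OF x] by blast
    show "layers_defined (Ls @ [map node ks]) (map (\<lambda>u. node_out u UNIV (($) x)) L)"
      using out[OF x] ks x nz by (auto simp: layers_defined_snoc node_defined_def arg) (auto simp: node_def)
    show "layers_out (Ls @ [map node ks]) (map (\<lambda>u. node_out u UNIV (($) x)) L) = map (\<lambda>F. F x) Fs'"
      using out[OF x] ks x by (auto simp: layers_out_snoc layer_out_def node_out_def arg Fs'_def)
        (auto simp: node_def G_def)
  next
    fix L' u assume *: "L' \<in> set (Ls @ [map node ks])" "u \<in> set L'"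
    show "rational_node u"
    proof (cases "L' \<in> set Ls")
      case False
      then obtain i where i: "u = node i" "i \<in> I" using * ks by auto
      \<comment> \<open>A denominator without zeros on the cube is a nonzero polynomial, because the
        cube has a point.\<close>
      have "q i \<noteq> 0" using nz[OF i(2) zero_in_unit_cube] by auto
      then show ?thesis using deg i by (simp add: rational_node_def node_def)
    qed (use * rat in blast)
  next
    show "length Fs' = length L + sum_list (map length (Ls @ [map node ks]))"
      using len by (simp add: Fs'_def)
    show "Suc t = 1 + length (Ls @ [map node ks])" using len by simp
  qed (use rat in blast)
  moreover have "length Fs' = length Fs + card I"
    using ks by (auto simp: Fs'_def distinct_card)
  moreover have "aff_span Fs \<subseteq> aff_span Fs'" unfolding Fs'_def by (rule aff_span_append)
  moreover have "(\<lambda>x. poly (p i) (a i x) / poly (q i) (a i x)) \<in> aff_span Fs'" if "i \<in> I" for i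
  proof -
    have "G i \<in> aff_span Fs'" using that ks by (intro aff_span_mem) (auto simp: Fs'_def)
    then show ?thesis unfolding G_def .
  qed
  ultimately show thesis by (rule that)
qed

lemma layered_add_squares:
  fixes Fs :: "(real^'d::finite \<Rightarrow> real) list"
  assumes "layered Fs t" "finite I" "\<And>i. i \<in> I \<Longrightarrow> a i \<in> aff_span Fs"
  obtains Fs' where "layered Fs' (Suc t)" "length Fs' = length Fs + card I"
    "aff_span Fs \<subseteq> aff_span Fs'" "\<And>i. i \<in> I \<Longrightarrow> (\<lambda>x. (a i x)\<^sup>2) \<in> aff_span Fs'"
  by (rule layered_add_layer[OF assms, where p = "\<lambda>_. [:0, 0, 1:]" and q = "\<lambda>_. 1"])
    (auto simp: power2_eq_square)

lemma layered_add_inverses: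
  fixes Fs :: "(real^'d::finite \<Rightarrow> real) list"
  assumes "layered Fs t" "finite I" "\<And>i. i \<in> I \<Longrightarrow> a i \<in> aff_span Fs"
    and "\<And>i x. i \<in> I \<Longrightarrow> x \<in> unit_cube \<Longrightarrow> a i x \<noteq> 0"
  obtains Fs' where "layered Fs' (Suc t)" "length Fs' = length Fs + card I"
    "aff_span Fs \<subseteq> aff_span Fs'" "\<And>i. i \<in> I \<Longrightarrow> (\<lambda>x. 1 / a i x) \<in> aff_span Fs'"
  by (rule layered_add_layer[OF assms(1-3), where p = "\<lambda>_. 1" and q = "\<lambda>_. [:0, 1:]"])
    (auto simp: assms(4))

lemma layered_add_products:
  fixes Fs :: "(real^'d::finite \<Rightarrow> real) list"
  assumes lay: "layered Fs t" and fin: "finite I"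
    and ab: "\<And>i. i \<in> I \<Longrightarrow> a i \<in> aff_span Fs" "\<And>i. i \<in> I \<Longrightarrow> b i \<in> aff_span Fs"
  obtains Fs' where "layered Fs' (Suc t)" "length Fs' = length Fs + 2 * card I"
    "aff_span Fs \<subseteq> aff_span Fs'" "\<And>i. i \<in> I \<Longrightarrow> (\<lambda>x. a i x * b i x) \<in> aff_span Fs'"
proof -
  \<comment> \<open>\<open>a * b = ((a + b)\<^sup>2 - (a - b)\<^sup>2) / 4\<close>\<close>
  define c where "c = (\<lambda>(i, s) x. a i x + (if s then 1 else - 1) * b i x)"
  obtain Fs' where Fs': "layered Fs' (Suc t)" "length Fs' = length Fs + card (I \<times> (UNIV :: bool set))"
    "aff_span Fs \<subseteq> aff_span Fs'" "\<And>j. j \<in> I \<times> UNIV \<Longrightarrow> (\<lambda>x. (c j x)\<^sup>2) \<in> aff_span Fs'"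
  proof (rule layered_add_squares[OF lay, where I = "I \<times> (UNIV :: bool set)" and a = c])
    show "c j \<in> aff_span Fs" if "j \<in> I \<times> UNIV" for j
      using that ab by (auto simp: c_def split_beta intro!: aff_span_add aff_span_diff aff_span_cmult)
  qed (use fin in auto)
  show thesis
  proof (rule that[of Fs'])
    fix i assume i: "i \<in> I"
    have mem: "(\<lambda>x. (1 / 4) * ((c (i, True) x)\<^sup>2 - (c (i, False) x)\<^sup>2)) \<in> aff_span Fs'"
      using Fs'(4) i by (intro aff_span_cmult aff_span_diff) auto
    show "(\<lambda>x. a i x * b i x) \<in> aff_span Fs'"
      by (rule aff_span_cong[OF mem]) (simp add: c_def power2_eq_square algebra_simps)
  qed (use Fs' in \<open>auto simp: card_cartesian_product\<close>)
qed

text \<open>One layer of products per degree. The length of \<open>Fs\<close> can stay unspecified: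
  this part of the network is fixed before the grid is chosen and adds a constant to the size. The
  coordinates form a separate clause because they are not among the monomials when
  \<open>k = 0\<close>.\<close>

lemma layered_monomials:
  "\<exists>Fs :: (real^'d::finite \<Rightarrow> real) list. layered Fs (Suc k) \<and>
    (\<forall>ks. length ks \<le> k \<longrightarrow> monomial ks \<in> aff_span Fs) \<and> (\<forall>i. (\<lambda>x. x $ i) \<in> aff_span Fs)"
proof (induction k)
  case 0
  obtain Fs :: "(real^'d \<Rightarrow> real) list" where "layered Fs 1" "\<And>i. (\<lambda>x. x $ i) \<in> aff_span Fs"
    by (rule layered_coordinates) blast
  moreover have "monomial [] \<in> aff_span Fs"
    by (rule aff_span_cong[OF aff_span_const]) (rule monomial_Nil)
  ultimately show ?case by (intro exI[of _ Fs]) (auto simp: aff_span_const)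
next
  case (Suc k)
  then obtain Fs :: "(real^'d \<Rightarrow> real) list" where Fs: "layered Fs (Suc k)"
    "\<And>ks. length ks \<le> k \<Longrightarrow> monomial ks \<in> aff_span Fs" "\<And>i. (\<lambda>x. x $ i) \<in> aff_span Fs"
    by blast
  obtain Fs' where Fs': "layered Fs' (Suc (Suc k))" "aff_span Fs \<subseteq> aff_span Fs'"
    "\<And>j. j \<in> (UNIV :: 'd set) \<times> {ks. length ks \<le> k} \<Longrightarrow> (\<lambda>x. x $ fst j * monomial (snd j) x) \<in> aff_span Fs'"
    by (rule layered_add_products[OF Fs(1), where I = "(UNIV :: 'd set) \<times> {ks. length ks \<le> k}"
          and a = "\<lambda>j x. x $ fst j" and b = "\<lambda>j. monomial (snd j)"])
      (use Fs in \<open>auto intro!: finite_cartesian_product finite_lists_le\<close>)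
  have "monomial ks \<in> aff_span Fs'" if "length ks \<le> Suc k" for ks
  proof (cases ks)
    case Nil
    then show ?thesis using Fs(2)[of "[]"] Fs'(2) by auto
  next
    case (Cons i js)
    then have "monomial ks = (\<lambda>x. x $ i * monomial js x)" by (auto simp: monomial_Cons)
    then show ?thesis using Fs'(3)[of "(i, js)"] that Cons by simp
  qed
  then show ?case using Fs' Fs(3) by blast
qed

lemma layered_network:
  fixes Fs :: "(real^'d::finite \<Rightarrow> real) list"
  assumes "layered Fs t" "h \<in> aff_span Fs"
  obtains N :: "'d network" where "rational_network N" "network_size N = length Fs"
    "network_depth N = t" "\<And>x. x \<in> unit_cube \<Longrightarrow> network_fun N x = h x"
proof -
  obtain L :: "'d node list" and Ls where
    L: "\<forall>u\<in>set L. rational_node u" "\<forall>L\<in>set Ls. \<forall>u\<in>set L. rational_node u"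
    "length Fs = length L + sum_list (map length Ls)" "t = 1 + length Ls"
    and out: "\<And>x. x \<in> unit_cube \<Longrightarrow> (\<forall>u\<in>set L. node_defined u UNIV (($) x)) \<and>
      layers_defined Ls (map (\<lambda>u. node_out u UNIV (($) x)) L) \<and>
      layers_out Ls (map (\<lambda>u. node_out u UNIV (($) x)) L) = map (\<lambda>F. F x) Fs"
    using assms(1) unfolding layered_def by blast
  obtain b w where bw: "\<forall>x\<in>unit_cube. h x = b + (\<Sum>j<length Fs. w j * (Fs ! j) x)"
    using assms(2) unfolding aff_span_def by blast
  show thesis
    by (rule that[of "Network L Ls w b"])
      (use L out bw in \<open>auto simp: rational_network_def defined_on_cube_def first_out_def
        network_size_def network_depth_def network_fun_def node_outputs_def\<close>)
qed

text \<open>\<open>M\<close> and \<open>D\<close> precede \<open>N\<close> and \<open>c\<close>. A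
  grid point only costs the computation of its weight; the multiplications by monomials and the
  final division are shared by all grid points, and \<open>c\<close> occurs only in weights of the
  network.\<close>

lemma shepard_network:
  fixes n q :: nat
  obtains M D :: nat where
    "\<And>N (c :: real^'d::finite \<Rightarrow> 'd list \<Rightarrow> real). \<exists>Net :: 'd network. rational_network Net \<and>
      network_size Net \<le> M * (N + 1) ^ CARD('d) \<and> network_depth Net \<le> D \<and>
      (\<forall>x\<in>unit_cube. network_fun Net x =
        (\<Sum>m\<in>grid N. shepard_weight (2 ^ q) (real N *\<^sub>R x - m) * (\<Sum>ks | length ks \<le> n. c m ks * monomial ks x))
        / (\<Sum>m\<in>grid N. shepard_weight (2 ^ q) (real N *\<^sub>R x - m)))"
proof -
  \<comment> \<open>Degree \<open>n\<close> is needed for the local polynomials and degree 2 for the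
    squared distances to the grid points; \<open>n + 2\<close> covers both.\<close>
  obtain Fs0 :: "(real^'d \<Rightarrow> real) list" where Fs0: "layered Fs0 (Suc (n + 2))"
    "\<And>ks. length ks \<le> n + 2 \<Longrightarrow> monomial ks \<in> aff_span Fs0"
    using layered_monomials[of "n + 2"] by blast
  define l where "l = card {ks :: 'd list. length ks \<le> n}"
  define s where "s = length Fs0"
  show thesis
  \<comment> \<open>Size: \<open>s\<close> nodes for the monomials, one inversion and
    \<open>q\<close> squarings per grid point, two nodes for each of the \<open>l\<close> products,
    and 1 + 2 nodes for the inversion of the denominator and the last product. Depth:
    \<open>n + 3\<close> layers for the monomials, \<open>1 + q\<close> for the weights and 3 at the
    end.\<close>
  proof (rule that[of "s + 1 + q + 2 * l + 3" "n + 7 + q"], goal_cases)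
    case (1 N c)
    define y where "y m x = 1 + (\<Sum>i\<in>UNIV. ((real N *\<^sub>R x - m) $ i)\<^sup>2)" for m x :: "real^'d"
    define G where "G = card (grid N :: (real^'d) set)"
    have y1: "y m x \<ge> 1" for m x unfolding y_def by (simp add: sum_nonneg)
    have ymem: "y m \<in> aff_span Fs0" for m
    proof -
      \<comment> \<open>The expanded squared distance is affine in monomials of degree at most 2, so
        the inversions for all grid points fit into one layer directly above the monomials.\<close>
      have "(\<lambda>x. 1 + (\<Sum>i\<in>UNIV. (real N)\<^sup>2 * monomial [i, i] x + (- 2 * real N * m $ i) * monomial [i] x + (m $ i)\<^sup>2))
          \<in> aff_span Fs0"
        by (intro aff_span_add aff_span_const aff_span_sum aff_span_cmult Fs0(2)) auto
      then show ?thesis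
        by (rule aff_span_cong) (simp add: y_def monomial_def power2_eq_square algebra_simps)
    qed
    have "\<exists>Fs. layered Fs (n + 4 + j) \<and> length Fs = s + (1 + j) * G \<and>
      aff_span Fs0 \<subseteq> aff_span Fs \<and> (\<forall>m\<in>grid N. (\<lambda>x. (1 / y m x) ^ (2 ^ j)) \<in> aff_span Fs)" for j
    proof (induction j)
      case 0
      have y0: "y m x \<noteq> 0" for m x using y1[of m x] by simp
      obtain Fs where "layered Fs (Suc (Suc (n + 2)))" "length Fs = length Fs0 + G"
        "aff_span Fs0 \<subseteq> aff_span Fs" "\<And>m. m \<in> grid N \<Longrightarrow> (\<lambda>x. 1 / y m x) \<in> aff_span Fs"
        unfolding G_def
        by (rule layered_add_inverses[OF Fs0(1), where I = "grid N" and a = y]) (use finite_grid ymem y0 in blast)+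
      then show ?case by (intro exI[of _ Fs]) (simp add: s_def eval_nat_numeral)
    next
      case (Suc j)
      then obtain Fs where Fs: "layered Fs (n + 4 + j)" "length Fs = s + (1 + j) * G"
        "aff_span Fs0 \<subseteq> aff_span Fs" "\<And>m. m \<in> grid N \<Longrightarrow> (\<lambda>x. (1 / y m x) ^ (2 ^ j)) \<in> aff_span Fs"
        by blast
      obtain Fs' where Fs': "layered Fs' (Suc (n + 4 + j))" "length Fs' = length Fs + G"
        "aff_span Fs \<subseteq> aff_span Fs'" "\<And>m. m \<in> grid N \<Longrightarrow> (\<lambda>x. ((1 / y m x) ^ (2 ^ j))\<^sup>2) \<in> aff_span Fs'"
        unfolding G_def by (rule layered_add_squares[OF Fs(1) finite_grid Fs(4)]) auto
      have "(\<lambda>x. (1 / y m x) ^ (2 ^ Suc j)) \<in> aff_span Fs'" if "m \<in> grid N" for m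
        using Fs'(4)[OF that] by (simp add: power_mult[symmetric] mult.commute)
      with Fs' Fs show ?case by (intro exI[of _ Fs']) auto
    qed
    then obtain Fs1 where Fs1: "layered Fs1 (n + 4 + q)" "length Fs1 = s + (1 + q) * G"
      "aff_span Fs0 \<subseteq> aff_span Fs1"
      and w: "\<And>m. m \<in> grid N \<Longrightarrow> (\<lambda>x. shepard_weight (2 ^ q) (real N *\<^sub>R x - m)) \<in> aff_span Fs1"
      unfolding shepard_weight_def y_def by blast
    define B where "B x = (\<Sum>m\<in>grid N. shepard_weight (2 ^ q) (real N *\<^sub>R x - m))" for x :: "real^'d"
    have B0: "B x \<noteq> 0" for x
      using sum_shepard_weight_pos[of "2 ^ q" "real N *\<^sub>R x" N] by (simp add: B_def)
    define A where "A ks x = (\<Sum>m\<in>grid N. c m ks * shepard_weight (2 ^ q) (real N *\<^sub>R x - m))" for ks and x :: "real^'d"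
    have Bmem: "B \<in> aff_span Fs1" unfolding B_def by (intro aff_span_sum w)
    have Amem: "A ks \<in> aff_span Fs1" for ks unfolding A_def by (intro aff_span_sum aff_span_cmult w)
    obtain Fs2 where Fs2: "layered Fs2 (Suc (n + 4 + q))" "length Fs2 = length Fs1 + 2 * l"
      "aff_span Fs1 \<subseteq> aff_span Fs2"
      "\<And>ks. ks \<in> {ks. length ks \<le> n} \<Longrightarrow> (\<lambda>x. monomial ks x * A ks x) \<in> aff_span Fs2"
      unfolding l_def
      by (rule layered_add_products[OF Fs1(1), where I = "{ks. length ks \<le> n}" and a = monomial and b = A])
        (use Amem Fs0 Fs1 finite_lists_le in auto)
    obtain Fs3 where Fs3: "layered Fs3 (Suc (Suc (n + 4 + q)))" "length Fs3 = length Fs2 + 1"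
      "aff_span Fs2 \<subseteq> aff_span Fs3" "(\<lambda>x. 1 / B x) \<in> aff_span Fs3"
      by (rule layered_add_inverses[OF Fs2(1), where I = "{()}" and a = "\<lambda>_. B"])
        (use B0 Bmem Fs2 in auto)
    define E where "E x = (\<Sum>ks | length ks \<le> n. monomial ks x * A ks x)" for x
    have Emem: "E \<in> aff_span Fs3"
      unfolding E_def using Fs2(4) Fs3(3) by (intro aff_span_sum) auto
    obtain Fs4 where Fs4: "layered Fs4 (Suc (Suc (Suc (n + 4 + q))))" "length Fs4 = length Fs3 + 2"
      "(\<lambda>x. E x * (1 / B x)) \<in> aff_span Fs4"
      by (rule layered_add_products[OF Fs3(1), where I = "{()}" and a = "\<lambda>_. E" and b = "\<lambda>_ x. 1 / B x"])
        (use Emem Fs3 in auto)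
    obtain Net :: "'d network" where Net: "rational_network Net" "network_size Net = length Fs4"
      "network_depth Net = Suc (Suc (Suc (n + 4 + q)))"
      "\<And>x. x \<in> unit_cube \<Longrightarrow> network_fun Net x = E x * (1 / B x)"
      using layered_network[OF Fs4(1,3)] by blast
    have "network_size Net = s + (1 + q) * G + (2 * l + 3)"
      using Net(2) Fs4(2) Fs3(2) Fs2(2) Fs1(2) by simp
    also have "\<dots> \<le> s * G + (1 + q) * G + (2 * l + 3) * G"
    proof -
      have "G \<ge> 1" by (simp add: G_def card_grid)
      then have "k \<le> k * G" for k by simp
      then show ?thesis by (intro add_mono order.refl)
    qed
    also have "\<dots> = (s + 1 + q + 2 * l + 3) * (N + 1) ^ CARD('d)"
      by (simp add: G_def card_grid algebra_simps)
    finally have size: "network_size Net \<le> (s + 1 + q + 2 * l + 3) * (N + 1) ^ CARD('d)" .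
    have "E x = (\<Sum>m\<in>grid N. shepard_weight (2 ^ q) (real N *\<^sub>R x - m) * (\<Sum>ks | length ks \<le> n. c m ks * monomial ks x))" for x
      unfolding E_def A_def sum_distrib_left sum_distrib_right
      by (subst sum.swap) (simp add: mult_ac)
    then have "\<forall>x\<in>unit_cube. network_fun Net x =
        (\<Sum>m\<in>grid N. shepard_weight (2 ^ q) (real N *\<^sub>R x - m) * (\<Sum>ks | length ks \<le> n. c m ks * monomial ks x))
        / (\<Sum>m\<in>grid N. shepard_weight (2 ^ q) (real N *\<^sub>R x - m))"
      using Net(4) by (simp add: B_def)
    with size Net(1,3) show ?case by (intro exI[of _ Net]) auto
  qed
qed

section \<open>Mollification\<close>

text \<open>The kernel is supported in the cube with lower corner \<open>x\<close> and side \<open>\<delta>\<close>, not centred at \<open>x\<close>: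
  these are the cubes for which the library has the Lebesgue differentiation theorem. The product
  form makes iterated partial derivatives independent of their order.\<close>

definition kern :: "real \<Rightarrow> ('d::finite \<Rightarrow> nat) \<Rightarrow> real^'d \<Rightarrow> real^'d \<Rightarrow> real"
  where "kern \<delta> \<kappa> x y = (\<Prod>j\<in>UNIV. bump (\<kappa> j) ((y $ j - x $ j) / \<delta>))"

text \<open>Stated along an arbitrary line so that it yields both derivatives of the kernel: in the
  base point along any direction, for the Taylor expansion, and in the integration variable along an
  axis, for test functions.\<close>

lemma prod_bump_has_derivative:
  fixes \<kappa> :: "'d::finite \<Rightarrow> nat"
  shows "((\<lambda>t. \<Prod>j\<in>UNIV. bump (\<kappa> j) (c j + t * e j)) has_real_derivative
    (\<Sum>i\<in>UNIV. e i * (\<Prod>j\<in>UNIV. bump ((\<kappa>(i := Suc (\<kappa> i))) j) (c j + t * e j)))) (at t)"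
proof -
  have lin: "((\<lambda>t. c j + t * e j) has_real_derivative e j) (at t)" for j
    by (auto intro!: derivative_eq_intros)
  have "((\<lambda>t. bump (\<kappa> j) (c j + t * e j)) has_real_derivative bump (Suc (\<kappa> j)) (c j + t * e j) * e j) (at t)" for j
    by (rule DERIV_chain2[OF bump_has_derivative lin])
  then have "((\<lambda>t. \<Prod>j\<in>UNIV. bump (\<kappa> j) (c j + t * e j)) has_real_derivative
      (\<Sum>i\<in>UNIV. bump (Suc (\<kappa> i)) (c i + t * e i) * e i * (\<Prod>j\<in>UNIV - {i}. bump (\<kappa> j) (c j + t * e j)))) (at t)"
    by (intro has_field_derivative_prod)
  moreover have "bump (Suc (\<kappa> i)) (c i + t * e i) * e i * (\<Prod>j\<in>UNIV - {i}. bump (\<kappa> j) (c j + t * e j))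
      = e i * (\<Prod>j\<in>UNIV. bump ((\<kappa>(i := Suc (\<kappa> i))) j) (c j + t * e j))" for i
    by (subst prod.remove[of UNIV i]) (auto intro!: prod.cong simp: mult_ac)
  ultimately show ?thesis by simp
qed

lemma kern_has_derivative_left:
  "((\<lambda>t. kern \<delta> \<kappa> (x + t *\<^sub>R v) y) has_real_derivative
    (\<Sum>i\<in>UNIV. (- v $ i / \<delta>) * kern \<delta> (\<kappa>(i := Suc (\<kappa> i))) (x + t *\<^sub>R v) y)) (at t)"
proof -
  have "(y $ j - (x + t *\<^sub>R v) $ j) / \<delta> = (y $ j - x $ j) / \<delta> + t * (- v $ j / \<delta>)" for j t
    by (simp add: diff_divide_distrib add_divide_distrib)
  then show ?thesis
    using prod_bump_has_derivative[of \<kappa> "\<lambda>j. (y $ j - x $ j) / \<delta>" "\<lambda>j. - v $ j / \<delta>" t]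
    by (simp only: kern_def)
qed

lemma kern_has_derivative_axis:
  "((\<lambda>t. kern \<delta> \<kappa> x (y + t *\<^sub>R axis i 1)) has_real_derivative
    (1 / \<delta>) * kern \<delta> (\<kappa>(i := Suc (\<kappa> i))) x y) (at 0)"
proof -
  have eq: "((y + t *\<^sub>R axis i 1) $ j - x $ j) / \<delta> = (y $ j - x $ j) / \<delta> + t * (if j = i then 1 / \<delta> else 0)" for j t
    by (simp add: axis_def add_divide_distrib diff_divide_distrib)
  have *: "(\<Sum>k\<in>UNIV. (if k = i then 1 / \<delta> else 0) * (\<Prod>j\<in>UNIV. bump ((\<kappa>(k := Suc (\<kappa> k))) j) ((y $ j - x $ j) / \<delta> + 0 * (if j = i then 1 / \<delta> else 0))))
      = (1 / \<delta>) * kern \<delta> (\<kappa>(i := Suc (\<kappa> i))) x y"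
    by (subst sum.remove[of UNIV i]) (auto simp: kern_def)
  show ?thesis
    using prod_bump_has_derivative[of \<kappa> "\<lambda>j. (y $ j - x $ j) / \<delta>" "\<lambda>j. if j = i then 1 / \<delta> else 0" 0]
    unfolding kern_def[of \<delta> \<kappa>] eq * .
qed

lemma kern_bounded:
  fixes \<kappa> :: "'d::finite \<Rightarrow> nat"
  obtains M where "M > 0" "\<And>\<delta> x y. \<bar>kern \<delta> \<kappa> x y\<bar> \<le> M"
proof -
  have "\<forall>k. \<exists>M>0. \<forall>t. \<bar>bump k t\<bar> \<le> M" using bump_bounded by metis
  then obtain M where M: "\<And>k. M k > 0" "\<And>k t. \<bar>bump k t\<bar> \<le> M k" by metis
  have "\<bar>kern \<delta> \<kappa> x y\<bar> \<le> (\<Prod>j\<in>UNIV. M (\<kappa> j))" for \<delta> and x y :: "real^'d"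
    unfolding kern_def abs_prod using M by (intro prod_mono) auto
  moreover have "(\<Prod>j\<in>UNIV. M (\<kappa> j)) > 0" using M by (intro prod_pos) auto
  ultimately show thesis using that by blast
qed

lemma continuous_on_kern: "continuous_on S (kern \<delta> \<kappa> x)"
proof -
  have "continuous_on S (\<lambda>y. \<Prod>j\<in>UNIV. bump (\<kappa> j) ((y $ j - x $ j) * (1 / \<delta>)))"
    by (intro continuous_on_prod continuous_on_compose2[OF continuous_on_bump[of UNIV]] continuous_intros) auto
  then show ?thesis by (simp add: kern_def[abs_def])
qed

lemma kern_measurable: "kern \<delta> \<kappa> x \<in> borel_measurable lebesgue"
  by (intro measurable_completion) (simp add: borel_measurable_continuous_onI continuous_on_kern)

lemma kern_nonneg: "kern \<delta> (\<lambda>_. 0) x y \<ge> 0"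
  unfolding kern_def by (intro prod_nonneg bump_0_nonneg)

lemma kern_support:
  assumes "kern \<delta> \<kappa> x y \<noteq> 0" "\<delta> > 0"
  shows "x $ j < y $ j" "y $ j < x $ j + \<delta>"
proof -
  have "bump (\<kappa> j) ((y $ j - x $ j) / \<delta>) \<noteq> 0"
    using assms(1) by (auto simp: kern_def)
  then have "0 < (y $ j - x $ j) / \<delta>" "(y $ j - x $ j) / \<delta> < 1"
    using bump_eq_0 by blast+
  then show "x $ j < y $ j" "y $ j < x $ j + \<delta>"
    using assms(2) by (auto simp: field_simps zero_less_divide_iff)
qed

lemma iter_partial_kern:
  "iter_partial ks (kern \<delta> (\<lambda>_. 0) x) = (\<lambda>y. (1 / \<delta>) ^ length ks * kern \<delta> (count_list ks) x y)"
proof (induction ks)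
  case Nil
  have "count_list [] = (\<lambda>_. 0 :: nat)" by auto
  then show ?case by simp
next
  case (Cons i ks)
  have c: "count_list (i # ks) = (count_list ks)(i := Suc (count_list ks i))" by auto
  have "deriv (\<lambda>t. (1 / \<delta>) ^ length ks * kern \<delta> (count_list ks) x (y + t *\<^sub>R axis i 1)) 0
      = (1 / \<delta>) ^ length ks * ((1 / \<delta>) * kern \<delta> (count_list (i # ks)) x y)" for y
    unfolding c by (intro DERIV_imp_deriv DERIV_cmult kern_has_derivative_axis)
  then show ?case
    by (simp add: Cons partial_deriv_def fun_eq_iff mult_ac del: count_list.simps)
qed

lemma smooth_kern: "smooth (kern \<delta> (\<lambda>_. 0) x)"
  unfolding smooth_def iter_partial_kern
proof (intro allI conjI)
  fix ks i y
  show "continuous_on UNIV (\<lambda>y. (1 / \<delta>) ^ length ks * kern \<delta> (count_list ks) x y)"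
    by (intro continuous_on_mult_left continuous_on_kern)
  show "(\<lambda>t. (1 / \<delta>) ^ length ks * kern \<delta> (count_list ks) x (y + t *\<^sub>R axis i 1)) differentiable at 0"
    using DERIV_cmult[OF kern_has_derivative_axis] real_differentiable_def by blast
qed

lemma test_function_kern:
  assumes "\<delta> > 0" "\<And>j. 0 < x $ j" "\<And>j. x $ j + \<delta> < 1"
  shows "test_function (kern \<delta> (\<lambda>_. 0) x)"
proof -
  have "{y. kern \<delta> (\<lambda>_. 0) x y \<noteq> 0} \<subseteq> cbox x (x + (\<chi> j. \<delta>))"
    using kern_support[OF _ assms(1)] by (force simp: mem_box_cart less_imp_le)
  then have *: "closure {y. kern \<delta> (\<lambda>_. 0) x y \<noteq> 0} \<subseteq> cbox x (x + (\<chi> j. \<delta>))"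
    by (intro closure_minimal closed_cbox)
  moreover have "cbox x (x + (\<chi> j. \<delta>)) \<subseteq> box 0 1"
    using assms by (auto simp: mem_box_cart) (smt (verit))+
  moreover have "compact (closure {y. kern \<delta> (\<lambda>_. 0) x y \<noteq> 0})"
    using * bounded_cbox bounded_subset compact_eq_bounded_closed closed_closure by blast
  ultimately show ?thesis using smooth_kern unfolding test_function_def by blast
qed

section \<open>Differentiation under the integral sign\<close>

lemma integrable_mult_bounded:
  fixes F h :: "'a \<Rightarrow> real"
  assumes "integrable M F" "h \<in> borel_measurable M" "\<And>y. \<bar>h y\<bar> \<le> C"
  shows "integrable M (\<lambda>y. F y * h y)"
proof (rule Bochner_Integration.integrable_bound)
  show "integrable M (\<lambda>y. C * F y)" using assms by simp
  show "(\<lambda>y. F y * h y) \<in> borel_measurable M" using assms by auto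
  show "AE y in M. norm (F y * h y) \<le> norm (C * F y)"
  proof (intro AE_I2)
    fix y
    have "\<bar>h y\<bar> \<le> \<bar>C\<bar>" using assms(3)[of y] by linarith
    then show "norm (F y * h y) \<le> norm (C * F y)" by (simp add: abs_mult mult.commute[of "\<bar>C\<bar>"] mult_left_mono)
  qed
qed

text \<open>The mean value inequality twice: \<open>f'\<close> is Lipschitz with constant
  \<open>C\<close>, so \<open>f s - s * f' t\<close> has derivative at most
  \<open>C * \<bar>h\<bar>\<close> in absolute value on the segment from \<open>t\<close> to
  \<open>t + h\<close>.\<close>

lemma DERIV_quadratic_remainder:
  fixes f f' :: "real \<Rightarrow> real"
  assumes "\<And>t. (f has_real_derivative f' t) (at t)" "\<And>t. (f' has_real_derivative f'' t) (at t)"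
    "\<And>t. \<bar>f'' t\<bar> \<le> C"
  shows "\<bar>f (t + h) - f t - h * f' t\<bar> \<le> C * h\<^sup>2"
proof -
  have C: "C \<ge> 0" using assms(3)[of 0] by linarith
  have lip: "\<bar>f' a - f' b\<bar> \<le> C * \<bar>a - b\<bar>" for a b
    using field_differentiable_bound[of UNIV f' f'' C a b] assms by simp
  define S where "S = closed_segment t (t + h)"
  have "norm ((\<lambda>s. f s - s * f' t) (t + h) - (\<lambda>s. f s - s * f' t) t) \<le> (C * \<bar>h\<bar>) * norm (t + h - t)"
  proof (rule field_differentiable_bound[where S = S])
    show "((\<lambda>s. f s - s * f' t) has_field_derivative f' s - f' t) (at s within S)" if "s \<in> S" for s
      by (rule has_field_derivative_at_within) (auto intro!: derivative_eq_intros assms)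
    fix s assume "s \<in> S"
    then have "\<bar>s - t\<bar> \<le> \<bar>h\<bar>"
      unfolding S_def closed_segment_eq_real_ivl by (auto split: if_splits)
    then show "norm (f' s - f' t) \<le> C * \<bar>h\<bar>"
      using lip[of s t] C by (smt (verit) mult_left_mono real_norm_def)
  qed (auto simp: S_def)
  then show ?thesis by (simp add: algebra_simps power2_eq_square abs_mult_self_eq flip: abs_mult)
qed

text \<open>A bounded second derivative replaces dominated convergence: integrating the quadratic
  remainder against \<open>F\<close> shows that the integral differs from its linearisation at
  \<open>t\<close> by at most \<open>C2 * I * (s - t)\<^sup>2\<close>, which has derivative 0 at
  \<open>t\<close>.\<close>

lemma integral_has_derivative_if_bounded:
  fixes F :: "'a::euclidean_space \<Rightarrow> real" and \<psi> \<psi>1 \<psi>2 :: "real \<Rightarrow> 'a \<Rightarrow> real"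
  assumes F: "integrable M F"
    and d: "\<And>t y. ((\<lambda>t. \<psi> t y) has_real_derivative \<psi>1 t y) (at t)"
      "\<And>t y. ((\<lambda>t. \<psi>1 t y) has_real_derivative \<psi>2 t y) (at t)"
    and bd: "\<And>t y. \<bar>\<psi> t y\<bar> \<le> C0" "\<And>t y. \<bar>\<psi>1 t y\<bar> \<le> C1" "\<And>t y. \<bar>\<psi>2 t y\<bar> \<le> C2"
    and me: "\<And>t. \<psi> t \<in> borel_measurable M" "\<And>t. \<psi>1 t \<in> borel_measurable M"
  shows "((\<lambda>t. \<integral>y. F y * \<psi> t y \<partial>M) has_real_derivative (\<integral>y. F y * \<psi>1 t y \<partial>M)) (at t)"
proof -
  define I where "I = (\<integral>y. \<bar>F y\<bar> \<partial>M)"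
  define u where "u t = (\<integral>y. F y * \<psi> t y \<partial>M)" for t
  have i0: "integrable M (\<lambda>y. F y * \<psi> t y)" for t by (rule integrable_mult_bounded[OF F me(1) bd(1)])
  have i1: "integrable M (\<lambda>y. F y * \<psi>1 t y)" for t by (rule integrable_mult_bounded[OF F me(2) bd(2)])
  have "((\<lambda>s. u s - u t - (s - t) * (\<integral>y. F y * \<psi>1 t y \<partial>M)) has_real_derivative 0) (at t)"
  proof (rule DERIV_zero_if_quadratic_bound[where C = "C2 * I"])
    fix s
    have "u s - u t - (s - t) * (\<integral>y. F y * \<psi>1 t y \<partial>M) = (\<integral>y. F y * \<psi> s y - F y * \<psi> t y - (s - t) * (F y * \<psi>1 t y) \<partial>M)"
      unfolding u_def using i0 i1 by simp
    also have "\<bar>\<dots>\<bar> \<le> (\<integral>y. C2 * (s - t)\<^sup>2 * \<bar>F y\<bar> \<partial>M)"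
    proof (rule integral_abs_bound_integral)
      fix y
      have "\<bar>\<psi> (t + (s - t)) y - \<psi> t y - (s - t) * \<psi>1 t y\<bar> \<le> C2 * (s - t)\<^sup>2"
        by (rule DERIV_quadratic_remainder[OF d bd(3)])
      then have "\<bar>F y\<bar> * \<bar>\<psi> s y - \<psi> t y - (s - t) * \<psi>1 t y\<bar> \<le> \<bar>F y\<bar> * (C2 * (s - t)\<^sup>2)"
        by (intro mult_left_mono) auto
      then show "\<bar>F y * \<psi> s y - F y * \<psi> t y - (s - t) * (F y * \<psi>1 t y)\<bar> \<le> C2 * (s - t)\<^sup>2 * \<bar>F y\<bar>"
        by (simp add: algebra_simps flip: abs_mult)
    qed (use i0 i1 F in auto)
    also have "\<dots> = C2 * I * (s - t)\<^sup>2" by (simp add: I_def)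
    finally show "\<bar>u s - u t - (s - t) * (\<integral>y. F y * \<psi>1 t y \<partial>M)\<bar> \<le> C2 * I * (s - t)\<^sup>2" .
  qed
  moreover have "((\<lambda>s. u t + (s - t) * (\<integral>y. F y * \<psi>1 t y \<partial>M)) has_real_derivative
      (\<integral>y. F y * \<psi>1 t y \<partial>M)) (at t)"
    by (auto intro!: derivative_eq_intros)
  ultimately show ?thesis using DERIV_add by (fastforce simp: u_def)
qed

definition conv :: "(real^'d::finite \<Rightarrow> real) \<Rightarrow> real \<Rightarrow> ('d \<Rightarrow> nat) \<Rightarrow> real^'d \<Rightarrow> real"
  where "conv F \<delta> \<kappa> x = (\<integral>y. F y * kern \<delta> \<kappa> x y \<partial>lebesgue)"

lemma integrable_mult_kern:
  "integrable lebesgue F \<Longrightarrow> integrable lebesgue (\<lambda>y. F y * kern \<delta> \<kappa> x y)"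
  using integrable_mult_bounded[OF _ kern_measurable] kern_bounded by metis

lemma conv_has_derivative:
  fixes F :: "real^'d::finite \<Rightarrow> real"
  assumes F: "integrable lebesgue F"
  shows "((\<lambda>t. conv F \<delta> \<kappa> (x + t *\<^sub>R v)) has_real_derivative
    (\<Sum>i\<in>UNIV. (- v $ i / \<delta>) * conv F \<delta> (\<kappa>(i := Suc (\<kappa> i))) (x + t *\<^sub>R v))) (at t)"
proof -
  \<comment> \<open>The bound is taken as a function of \<kappa>, since the kernel and its first and
    second derivatives involve different orders.\<close>
  have "\<forall>\<kappa> :: 'd \<Rightarrow> nat. \<exists>M>0. \<forall>\<delta> x y. \<bar>kern \<delta> \<kappa> x y\<bar> \<le> M" using kern_bounded by metis
  then obtain M where M: "\<And>(\<kappa> :: 'd \<Rightarrow> nat) \<delta> x y. \<bar>kern \<delta> \<kappa> x y\<bar> \<le> M \<kappa>" by metis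
  define e where "e i = - v $ i / \<delta>" for i
  define S where "S \<kappa> i = \<kappa>(i := Suc (\<kappa> i))" for \<kappa> :: "'d \<Rightarrow> nat" and i
  have d: "((\<lambda>t. kern \<delta> \<kappa> (x + t *\<^sub>R v) y) has_real_derivative
      (\<Sum>i\<in>UNIV. e i * kern \<delta> (S \<kappa> i) (x + t *\<^sub>R v) y)) (at t)" for \<kappa> t y
    unfolding e_def S_def by (rule kern_has_derivative_left)
  have bd: "\<bar>\<Sum>i\<in>UNIV. e i * h i\<bar> \<le> (\<Sum>i\<in>UNIV. \<bar>e i\<bar> * C i)" if "\<And>i. \<bar>h i\<bar> \<le> C i" for h C :: "'d \<Rightarrow> real"
    by (rule order.trans[OF sum_abs]) (auto simp: abs_mult that intro!: sum_mono mult_left_mono)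
  have "((\<lambda>t. \<integral>y. F y * kern \<delta> \<kappa> (x + t *\<^sub>R v) y \<partial>lebesgue) has_real_derivative
      (\<integral>y. F y * (\<Sum>i\<in>UNIV. e i * kern \<delta> (S \<kappa> i) (x + t *\<^sub>R v) y) \<partial>lebesgue)) (at t)"
  proof (rule integral_has_derivative_if_bounded[OF F d])
    show "((\<lambda>t. \<Sum>i\<in>UNIV. e i * kern \<delta> (S \<kappa> i) (x + t *\<^sub>R v) y) has_real_derivative
      (\<Sum>i\<in>UNIV. e i * (\<Sum>j\<in>UNIV. e j * kern \<delta> (S (S \<kappa> i) j) (x + t *\<^sub>R v) y))) (at t)" for t y
      by (intro DERIV_sum DERIV_cmult d)
    show "(\<lambda>y. \<Sum>i\<in>UNIV. e i * kern \<delta> (S \<kappa> i) (x + t *\<^sub>R v) y) \<in> borel_measurable lebesgue" for t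
      by (intro borel_measurable_sum borel_measurable_times borel_measurable_const kern_measurable)
  qed (rule M bd kern_measurable)+
  also have "(\<integral>y. F y * (\<Sum>i\<in>UNIV. e i * kern \<delta> (S \<kappa> i) (x + t *\<^sub>R v) y) \<partial>lebesgue)
      = (\<integral>y. (\<Sum>i\<in>UNIV. e i * (F y * kern \<delta> (S \<kappa> i) (x + t *\<^sub>R v) y)) \<partial>lebesgue)"
    by (simp add: sum_distrib_left mult_ac)
  also have "\<dots> = (\<Sum>i\<in>UNIV. e i * conv F \<delta> (S \<kappa> i) (x + t *\<^sub>R v))"
    unfolding conv_def by (subst Bochner_Integration.integral_sum) (auto intro!: integrable_mult_kern F)
  finally show ?thesis unfolding conv_def e_def S_def .
qed

section \<open>Taylor expansion of the convolution\<close>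

lemma lists_length_Suc_eq: "{ks :: 'd list. length ks = Suc k} = (\<lambda>(i, ks). i # ks) ` (UNIV \<times> {ks. length ks = k})"
  by (auto simp: length_Suc_conv image_iff)

lemma sum_lists_Suc:
  fixes f :: "'d::finite list \<Rightarrow> real"
  shows "(\<Sum>ks | length ks = Suc k. f ks) = (\<Sum>i\<in>UNIV. \<Sum>ks | length ks = k. f (i # ks))"
  unfolding lists_length_Suc_eq
  by (subst sum.reindex) (auto simp: inj_on_def sum.cartesian_product split_beta)

lemma sum_abs_monomial: "(\<Sum>ks | length ks = k. \<bar>monomial ks v\<bar>) = l1 v ^ k"
proof (induction k)
  case (Suc k)
  then show ?case
    by (simp add: sum_lists_Suc monomial_Cons abs_mult l1_def flip: sum_distrib_left sum_distrib_right)
qed (simp add: monomial_Nil)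

text \<open>The partial derivatives of \<open>conv F \<delta> (\<lambda>_. 0)\<close> at \<open>a\<close>; the sign is due to \<open>x\<close> occurring negatively
  in the kernel.\<close>

definition taylor_coeff :: "(real^'d::finite \<Rightarrow> real) \<Rightarrow> real \<Rightarrow> real^'d \<Rightarrow> 'd list \<Rightarrow> real"
  where "taylor_coeff F \<delta> a ks = (- 1 / \<delta>) ^ length ks * conv F \<delta> (count_list ks) a"

lemma taylor_coeff_has_derivative:
  assumes "integrable lebesgue F"
  shows "((\<lambda>t. taylor_coeff F \<delta> (a + t *\<^sub>R v) ks) has_real_derivative
    (\<Sum>i\<in>UNIV. v $ i * taylor_coeff F \<delta> (a + t *\<^sub>R v) (i # ks))) (at t)"
proof -
  have c: "count_list (i # ks) = (count_list ks)(i := Suc (count_list ks i))" for i by auto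
  have "((\<lambda>t. (- 1 / \<delta>) ^ length ks * conv F \<delta> (count_list ks) (a + t *\<^sub>R v)) has_real_derivative
    (- 1 / \<delta>) ^ length ks * (\<Sum>i\<in>UNIV. (- v $ i / \<delta>) * conv F \<delta> (count_list (i # ks)) (a + t *\<^sub>R v))) (at t)"
    unfolding c by (intro DERIV_cmult conv_has_derivative assms)
  moreover have "(- 1 / \<delta>) ^ length ks * (\<Sum>i\<in>UNIV. (- v $ i / \<delta>) * conv F \<delta> (count_list (i # ks)) (a + t *\<^sub>R v))
      = (\<Sum>i\<in>UNIV. v $ i * taylor_coeff F \<delta> (a + t *\<^sub>R v) (i # ks))"
    by (simp add: taylor_coeff_def sum_distrib_left mult_ac del: count_list.simps)
  ultimately show ?thesis by (simp add: taylor_coeff_def)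
qed

text \<open>The Maclaurin formula on [0, 1] for the restriction to the segment from \<open>a\<close>
  to \<open>x\<close>. Its \<open>k\<close>-th derivative \<open>U k\<close> is the sum over all
  lists of length \<open>k\<close>; the factor 1 / n! of the remainder is estimated by 1.\<close>

lemma conv_taylor:
  fixes F :: "real^'d::finite \<Rightarrow> real"
  assumes F: "integrable lebesgue F" and n: "n > 0"
    and bound: "\<And>t ks. 0 \<le> t \<Longrightarrow> t \<le> 1 \<Longrightarrow> length ks = n \<Longrightarrow> \<bar>taylor_coeff F \<delta> (a + t *\<^sub>R (x - a)) ks\<bar> \<le> c"
  shows "\<bar>conv F \<delta> (\<lambda>_. 0) x -
    (\<Sum>k<n. (\<Sum>ks | length ks = k. monomial ks (x - a) * taylor_coeff F \<delta> a ks) / fact k)\<bar> \<le> c * l1 (x - a) ^ n"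
proof -
  define U where "U k t = (\<Sum>ks | length ks = k. monomial ks (x - a) * taylor_coeff F \<delta> (a + t *\<^sub>R (x - a)) ks)" for k t
  have d: "(U k has_real_derivative U (Suc k) t) (at t)" for k t
  proof -
    have "(U k has_real_derivative (\<Sum>ks | length ks = k. monomial ks (x - a) *
        (\<Sum>i\<in>UNIV. (x - a) $ i * taylor_coeff F \<delta> (a + t *\<^sub>R (x - a)) (i # ks)))) (at t)"
      unfolding U_def by (intro DERIV_sum DERIV_cmult taylor_coeff_has_derivative F)
    also have "(\<Sum>ks | length ks = k. monomial ks (x - a) *
        (\<Sum>i\<in>UNIV. (x - a) $ i * taylor_coeff F \<delta> (a + t *\<^sub>R (x - a)) (i # ks))) = U (Suc k) t"
      unfolding U_def sum_lists_Suc sum_distrib_left monomial_Cons by (subst sum.swap) (simp add: mult_ac)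
    finally show ?thesis .
  qed
  obtain t where t: "0 < t" "t < 1"
    and eq: "U 0 1 = (\<Sum>k<n. (U k 0 / fact k) * 1 ^ k) + (U n t / fact n) * 1 ^ n"
    using Maclaurin[of 1 n U "U 0"] n d by auto
  have "\<bar>U n t\<bar> \<le> (\<Sum>ks | length ks = n. \<bar>monomial ks (x - a)\<bar> * c)"
    unfolding U_def using t bound
    by (intro order.trans[OF sum_abs] sum_mono) (auto simp: abs_mult intro!: mult_left_mono)
  also have "\<dots> = c * l1 (x - a) ^ n" by (simp add: sum_abs_monomial flip: sum_distrib_right)
  finally have "\<bar>U n t\<bar> \<le> c * l1 (x - a) ^ n" .
  moreover have "\<bar>U n t\<bar> / fact n \<le> \<bar>U n t\<bar> / 1"
    by (intro divide_left_mono) (auto simp: fact_ge_1)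
  ultimately have "\<bar>U n t / fact n\<bar> \<le> c * l1 (x - a) ^ n" by simp
  moreover have "count_list [] = (\<lambda>_ :: 'd. 0 :: nat)" by auto
  then have "U 0 1 = conv F \<delta> (\<lambda>_. 0) x" by (simp add: U_def monomial_Nil taylor_coeff_def)
  ultimately show ?thesis using eq by (simp add: U_def)
qed

section \<open>Mass of the kernel and bounds from weak derivatives\<close>

lemma kern_integrable:
  fixes x :: "real^'d::finite"
  assumes "\<delta> > 0" shows "integrable lebesgue (kern \<delta> \<kappa> x)"
proof -
  have "integrable lebesgue (indicat_real (cbox x (x + (\<chi> j. \<delta>))))"
    by (rule integrable_real_indicator) (auto simp: emeasure_lborel_cbox_eq)
  note integrable_mult_kern[OF this, of \<delta> \<kappa> x]
  moreover have "indicat_real (cbox x (x + (\<chi> j. \<delta>))) y * kern \<delta> \<kappa> x y = kern \<delta> \<kappa> x y" for y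
    using kern_support[OF _ assms, of \<kappa> x y] by (auto simp: indicator_def mem_box_cart less_imp_le)
  ultimately show ?thesis by simp
qed

text \<open>The substitution y = x + \<delta> z reduces every kernel to the one on the unit cube.
  Its integral is positive because a nonnegative continuous function with integral 0 vanishes,
  whereas this one is positive at the centre.\<close>

lemma kern_integral:
  obtains c where "c > 0"
    "\<And>\<delta> (x :: real^'d::finite). \<delta> > 0 \<Longrightarrow> (\<integral>y. kern \<delta> (\<lambda>_. 0) x y \<partial>lebesgue) = c * \<delta> ^ CARD('d)"
proof -
  let ?k = "kern 1 (\<lambda>_. 0) (0 :: real^'d)"
  define c where "c = integral (cbox 0 1) ?k"
  have int: "(?k has_integral c) (cbox 0 1)"
    unfolding c_def by (intro integrable_integral integrable_continuous continuous_on_kern)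
  have "c \<noteq> 0"
  proof
    assume "c = 0"
    define h :: "real^'d" where "h = (\<chi> i. 1 / 2)"
    have "?k h = 0"
      by (rule has_integral_0_cbox_imp_0[OF continuous_on_kern _ int[unfolded \<open>c = 0\<close>]])
        (auto simp: kern_nonneg h_def mem_box_cart interval_ne_empty_cart)
    moreover have "?k h > 0" unfolding kern_def h_def by (intro prod_pos) (auto intro: bump_0_pos)
    ultimately show False by simp
  qed
  moreover have "c \<ge> 0" using int has_integral_nonneg kern_nonneg by blast
  ultimately have c: "c > 0" by simp
  moreover have "(\<integral>y. kern \<delta> (\<lambda>_. 0) x y \<partial>lebesgue) = c * \<delta> ^ CARD('d)" if "\<delta> > 0" for \<delta> and x :: "real^'d"
  proof -
    have "((\<lambda>y. ?k ((1 / \<delta>) *\<^sub>R y + (- (1 / \<delta>) *\<^sub>R x))) has_integral (1 / \<bar>1 / \<delta>\<bar> ^ DIM(real^'d)) *\<^sub>R c)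
       ((\<lambda>y. (1 / (1 / \<delta>)) *\<^sub>R y + - ((1 / (1 / \<delta>)) *\<^sub>R (- (1 / \<delta>) *\<^sub>R x))) ` cbox 0 1)"
      using that by (intro has_integral_affinity int) auto
    moreover have "?k ((1 / \<delta>) *\<^sub>R y + (- (1 / \<delta>) *\<^sub>R x)) = kern \<delta> (\<lambda>_. 0) x y" for y
      by (simp add: kern_def diff_divide_distrib)
    ultimately have "(kern \<delta> (\<lambda>_. 0) x has_integral c * \<delta> ^ CARD('d)) ((\<lambda>y. \<delta> *\<^sub>R y + x) ` cbox 0 1)"
      using that by (simp add: power_one_over mult.commute)
    then have 1: "(kern \<delta> (\<lambda>_. 0) x has_integral c * \<delta> ^ CARD('d)) UNIV"
    proof (rule has_integral_on_superset)
      fix y assume y: "y \<notin> (\<lambda>y. \<delta> *\<^sub>R y + x) ` cbox 0 1"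
      show "kern \<delta> (\<lambda>_. 0) x y = 0"
      proof (rule ccontr)
        assume nz: "kern \<delta> (\<lambda>_. 0) x y \<noteq> 0"
        have "(1 / \<delta>) *\<^sub>R (y - x) \<in> cbox 0 1"
          using kern_support[OF nz that] that by (auto simp: mem_box_cart divide_simps less_imp_le diff_le_eq algebra_simps)
        moreover have "y = \<delta> *\<^sub>R ((1 / \<delta>) *\<^sub>R (y - x)) + x" using that by simp
        ultimately show False using y by blast
      qed
    qed auto
    have "(kern \<delta> (\<lambda>_. 0) x has_integral (\<integral>y. kern \<delta> (\<lambda>_. 0) x y \<partial>lebesgue)) UNIV"
      by (intro has_integral_integral_lebesgue kern_integrable that)
    with 1 show ?thesis using has_integral_unique by blast
  qed
  ultimately show thesis by (rule that)
qed

text \<open>The kernel itself is the test function. Its derivatives in the integration variable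
  agree up to sign with those in the base point, so the derivatives of the convolution are, up to
  sign, integrals of the weak derivative \<open>g\<close> against the kernel.\<close>

lemma taylor_coeff_bound:
  fixes f g :: "real^'d::finite \<Rightarrow> real"
  assumes wd: "has_weak_deriv f (\<chi> i. count_list ks i) g"
    and g: "AE y in lebesgue. y \<in> box 0 1 \<longrightarrow> \<bar>g y\<bar> \<le> 1"
    and \<delta>: "\<delta> > 0" "\<And>j. 0 < x $ j" "\<And>j. x $ j + \<delta> < 1"
  shows "\<bar>taylor_coeff (\<lambda>y. indicator (box 0 1) y * f y) \<delta> x ks\<bar> \<le> (\<integral>y. kern \<delta> (\<lambda>_. 0) x y \<partial>lebesgue)"
proof -
  let ?\<phi> = "kern \<delta> (\<lambda>_. 0) x"
  \<comment> \<open>\<open>mi_deriv\<close> differentiates in the order of a chosen list. Such a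
    list exists, as \<open>ks\<close> shows, and the derivatives of the kernel depend only on the
    counts in it.\<close>
  define js where "js = (SOME is. \<forall>i. count_list is i = (\<chi> i. count_list ks i) $ i)"
  have "\<forall>i. count_list js i = (\<chi> i. count_list ks i) $ i"
    unfolding js_def by (rule someI[of _ ks]) simp
  then have js: "count_list js = count_list ks" by auto
  then have len: "length js = length ks"
    using sum_count_set[of js UNIV] sum_count_set[of ks UNIV] by simp
  have md: "mi_deriv (\<chi> i. count_list ks i) ?\<phi> = (\<lambda>y. (1 / \<delta>) ^ length ks * kern \<delta> (count_list ks) x y)"
  proof -
    have "mi_deriv (\<chi> i. count_list ks i) ?\<phi> = iter_partial js ?\<phi>"
      unfolding mi_deriv_def js_def by (rule refl)
    then show ?thesis by (simp only: iter_partial_kern js len)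
  qed
  have "(LINT y:box 0 1|lebesgue. f y * mi_deriv (\<chi> i. count_list ks i) ?\<phi> y)
      = (- 1) ^ mi_order (\<chi> i. count_list ks i) * (LINT y:box 0 1|lebesgue. g y * ?\<phi> y)"
    using wd test_function_kern[OF \<delta>] unfolding has_weak_deriv_def by blast
  then have "(LINT y:box 0 1|lebesgue. f y * ((1 / \<delta>) ^ length ks * kern \<delta> (count_list ks) x y))
      = (- 1) ^ mi_order (\<chi> i. count_list ks i) * (LINT y:box 0 1|lebesgue. g y * ?\<phi> y)"
    by (simp only: md)
  moreover have "(LINT y:box 0 1|lebesgue. f y * ((1 / \<delta>) ^ length ks * kern \<delta> (count_list ks) x y))
     = (1 / \<delta>) ^ length ks * conv (\<lambda>y. indicator (box 0 1) y * f y) \<delta> (count_list ks) x"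
  proof -
    have "indicat_real (box 0 1) y *\<^sub>R (f y * ((1 / \<delta>) ^ length ks * kern \<delta> (count_list ks) x y))
        = (1 / \<delta>) ^ length ks * (indicator (box 0 1) y * f y * kern \<delta> (count_list ks) x y)" for y
      by simp
    then show ?thesis
      unfolding set_lebesgue_integral_def conv_def by (simp only: integral_mult_right_zero)
  qed
  moreover have "(- 1 / \<delta>) ^ length ks = (- 1) ^ length ks * (1 / \<delta>) ^ length ks"
    by (simp flip: power_mult_distrib)
  ultimately have "\<bar>taylor_coeff (\<lambda>y. indicator (box 0 1) y * f y) \<delta> x ks\<bar> = \<bar>LINT y:box 0 1|lebesgue. g y * ?\<phi> y\<bar>"
    unfolding taylor_coeff_def by (simp only: mult.assoc) (simp add: abs_mult power_abs)
  also have "\<dots> \<le> (\<integral>y. ?\<phi> y \<partial>lebesgue)"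
  \<comment> \<open>If the integrand is not integrable, its integral is 0 by convention and the
    bound holds trivially.\<close>
  proof (cases "integrable lebesgue (\<lambda>y. indicator (box 0 1) y *\<^sub>R (g y * ?\<phi> y))")
    case True
    have "\<bar>LINT y:box 0 1|lebesgue. g y * ?\<phi> y\<bar> \<le> (\<integral>y. \<bar>indicator (box 0 1) y *\<^sub>R (g y * ?\<phi> y)\<bar> \<partial>lebesgue)"
      unfolding set_lebesgue_integral_def by (rule integral_abs_bound)
    also have "\<dots> \<le> (\<integral>y. ?\<phi> y \<partial>lebesgue)"
    proof (rule integral_mono_AE)
      show "AE y in lebesgue. \<bar>indicator (box 0 1) y *\<^sub>R (g y * ?\<phi> y)\<bar> \<le> ?\<phi> y"
        using g
      proof eventually_elim
        case (elim y)
        then show ?case using kern_nonneg[of \<delta> x y] mult_right_mono[of "\<bar>g y\<bar>" 1 "?\<phi> y"]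
          by (auto simp: indicator_def abs_mult)
      qed
    qed (use True kern_integrable \<delta> in auto)
    finally show ?thesis .
  next
    case False
    then show ?thesis unfolding set_lebesgue_integral_def
      by (simp add: not_integrable_integral_eq kern_nonneg)
  qed
  finally show ?thesis .
qed

section \<open>Mollification of Sobolev functions\<close>

text \<open>A weighted average of \<open>F\<close>. For positive \<delta> the denominator does not
  depend on \<open>x\<close>, so Taylor expansions of \<open>conv\<close> carry over by
  division.\<close>

definition mollify :: "(real^'d::finite \<Rightarrow> real) \<Rightarrow> real \<Rightarrow> real^'d \<Rightarrow> real"
  where "mollify F \<delta> x = conv F \<delta> (\<lambda>_. 0) x / (\<integral>y. kern \<delta> (\<lambda>_. 0) x y \<partial>lebesgue)"

text \<open>The base points whose kernel is an admissible test function; the asymmetry reflects that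
  the kernel sits at a corner of its cube.\<close>

definition inner_cube :: "real \<Rightarrow> (real^'d::finite) set"
  where "inner_cube \<delta> = {x. \<forall>j. 0 < x $ j \<and> x $ j + \<delta> < 1}"

lemma inner_cube_convex:
  assumes "a \<in> inner_cube \<delta>" "x \<in> inner_cube \<delta>" "0 \<le> t" "t \<le> 1"
  shows "a + t *\<^sub>R (x - a) \<in> inner_cube \<delta>"
  unfolding inner_cube_def
proof (intro CollectI allI)
  fix j
  have 1: "0 < a $ j" "a $ j < 1 - \<delta>" "0 < x $ j" "x $ j < 1 - \<delta>"
    using assms by (auto simp: inner_cube_def less_diff_eq)
  have "(1 - t) * a $ j + t * x $ j \<in> {0<..<1 - \<delta>}"
    using 1 assms convexD_alt[OF convex_real_interval(8), of "a $ j" 0 "1 - \<delta>" "x $ j" t] by auto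
  moreover have "(a + t *\<^sub>R (x - a)) $ j = (1 - t) * a $ j + t * x $ j" by (simp add: algebra_simps)
  ultimately show "0 < (a + t *\<^sub>R (x - a)) $ j \<and> (a + t *\<^sub>R (x - a)) $ j + \<delta> < 1" by auto
qed

text \<open>Order exactly \<open>n\<close>, since the Taylor remainder involves no other. It is
  applied with order 1, for the Lipschitz representative, and with the order of the Sobolev
  ball.\<close>

definition weak_derivs_bounded :: "nat \<Rightarrow> (real^'d::finite \<Rightarrow> real) \<Rightarrow> bool"
  where "weak_derivs_bounded n f \<longleftrightarrow> (\<forall>k. mi_order k = n \<longrightarrow>
    (\<exists>g. has_weak_deriv f k g \<and> (AE y in lebesgue. y \<in> box 0 1 \<longrightarrow> \<bar>g y\<bar> \<le> 1)))"

text \<open>The coefficients of order \<open>n\<close> are bounded by the mass of the kernel, and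
  normalising divides by the same mass. The remainder thus has constant 1 whatever \<delta>
  is.\<close>

lemma mollify_taylor:
  fixes f :: "real^'d::finite \<Rightarrow> real"
  defines "F \<equiv> \<lambda>y. indicator (box 0 1) y * f y"
  assumes F: "integrable lebesgue F" and wd: "weak_derivs_bounded n f" and n: "n > 0"
    and \<delta>: "\<delta> > 0" "a \<in> inner_cube \<delta>" "x \<in> inner_cube \<delta>"
  shows "\<bar>mollify F \<delta> x - (\<Sum>k<n. (\<Sum>ks | length ks = k. monomial ks (x - a) * taylor_coeff F \<delta> a ks) / fact k) /
    (\<integral>y. kern \<delta> (\<lambda>_. 0) x y \<partial>lebesgue)\<bar> \<le> l1 (x - a) ^ n"
proof -
  obtain c0 where c0: "c0 > 0" "\<And>\<delta> (x :: real^'d). \<delta> > 0 \<Longrightarrow> (\<integral>y. kern \<delta> (\<lambda>_. 0) x y \<partial>lebesgue) = c0 * \<delta> ^ CARD('d)"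
    using kern_integral by blast
  define c where "c = c0 * \<delta> ^ CARD('d)"
  have c: "c > 0" using c0 \<delta> by (simp add: c_def)
  have mass: "(\<integral>y. kern \<delta> (\<lambda>_. 0) z y \<partial>lebesgue) = c" for z :: "real^'d" using c0 \<delta> by (simp add: c_def)
  define T where "T = (\<Sum>k<n. (\<Sum>ks | length ks = k. monomial ks (x - a) * taylor_coeff F \<delta> a ks) / fact k)"
  have "\<bar>conv F \<delta> (\<lambda>_. 0) x - T\<bar> \<le> c * l1 (x - a) ^ n"
    unfolding T_def
  proof (rule conv_taylor[OF F n])
    fix t :: real and ks :: "'d list" assume t: "0 \<le> t" "t \<le> 1" and len: "length ks = n"
    have "mi_order (\<chi> i. count_list ks i) = n"
      using len sum_count_set[of ks UNIV] by (simp add: mi_order_def)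
    then obtain g where g: "has_weak_deriv f (\<chi> i. count_list ks i) g"
      "AE y in lebesgue. y \<in> box 0 1 \<longrightarrow> \<bar>g y\<bar> \<le> 1"
      using wd unfolding weak_derivs_bounded_def by blast
    have "a + t *\<^sub>R (x - a) \<in> inner_cube \<delta>" by (rule inner_cube_convex[OF \<delta>(2,3) t])
    then have "\<bar>taylor_coeff F \<delta> (a + t *\<^sub>R (x - a)) ks\<bar> \<le> (\<integral>y. kern \<delta> (\<lambda>_. 0) (a + t *\<^sub>R (x - a)) y \<partial>lebesgue)"
      unfolding F_def inner_cube_def by (intro taylor_coeff_bound[OF g \<delta>(1)]) blast+
    then show "\<bar>taylor_coeff F \<delta> (a + t *\<^sub>R (x - a)) ks\<bar> \<le> c" by (simp only: mass)
  qed
  moreover have "mollify F \<delta> x - T / c = (conv F \<delta> (\<lambda>_. 0) x - T) / c"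
    by (simp add: mollify_def mass diff_divide_distrib)
  ultimately show ?thesis
    using c by (simp only: mass T_def[symmetric]) (simp add: abs_divide pos_divide_le_eq mult.commute)
qed

text \<open>The case \<open>n = 1\<close> of the Taylor estimate, whose polynomial is the value at
  \<open>a\<close>.\<close>

lemma mollify_lipschitz:
  fixes f :: "real^'d::finite \<Rightarrow> real"
  defines "F \<equiv> \<lambda>y. indicator (box 0 1) y * f y"
  assumes "integrable lebesgue F" "weak_derivs_bounded 1 f" "\<delta> > 0" "a \<in> inner_cube \<delta>" "x \<in> inner_cube \<delta>"
  shows "\<bar>mollify F \<delta> x - mollify F \<delta> a\<bar> \<le> l1 (x - a)"
proof -
  obtain c0 where c0: "\<And>\<delta> (x :: real^'d). \<delta> > 0 \<Longrightarrow> (\<integral>y. kern \<delta> (\<lambda>_. 0) x y \<partial>lebesgue) = c0 * \<delta> ^ CARD('d)"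
    using kern_integral by blast
  have "count_list [] = (\<lambda>_ :: 'd. 0 :: nat)" by auto
  then show ?thesis
    using mollify_taylor[of f 1 \<delta> a x] assms c0[of \<delta> x] c0[of \<delta> a]
    by (simp add: monomial_Nil taylor_coeff_def mollify_def)
qed

lemma conv_minus_const:
  assumes "integrable lebesgue F" "\<delta> > 0"
  shows "conv F \<delta> \<kappa> x - q * (\<integral>y. kern \<delta> \<kappa> x y \<partial>lebesgue) = (\<integral>y. (F y - q) * kern \<delta> \<kappa> x y \<partial>lebesgue)"
    and "integrable lebesgue (\<lambda>y. (F y - q) * kern \<delta> \<kappa> x y)"
proof -
  have eq: "(F y - q) * kern \<delta> \<kappa> x y = F y * kern \<delta> \<kappa> x y - q * kern \<delta> \<kappa> x y" for y by (simp add: algebra_simps)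
  show "integrable lebesgue (\<lambda>y. (F y - q) * kern \<delta> \<kappa> x y)" unfolding eq
    by (simp add: integrable_mult_kern[OF assms(1)] kern_integrable[OF assms(2)])
  show "conv F \<delta> \<kappa> x - q * (\<integral>y. kern \<delta> \<kappa> x y \<partial>lebesgue) = (\<integral>y. (F y - q) * kern \<delta> \<kappa> x y \<partial>lebesgue)"
    unfolding eq conv_def
    by (simp add: integrable_mult_kern[OF assms(1)] kern_integrable[OF assms(2)])
qed

lemma mollify_near:
  fixes F :: "real^'d::finite \<Rightarrow> real"
  assumes F: "integrable lebesgue F" and \<delta>: "\<delta> > 0"
    and near: "AE y in lebesgue. (\<forall>j. x $ j < y $ j \<and> y $ j < x $ j + \<delta>) \<longrightarrow> \<bar>F y - q\<bar> \<le> r"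
  shows "\<bar>mollify F \<delta> x - q\<bar> \<le> r"
proof -
  obtain c0 where c0: "c0 > 0" "\<And>\<delta> (x :: real^'d). \<delta> > 0 \<Longrightarrow> (\<integral>y. kern \<delta> (\<lambda>_. 0) x y \<partial>lebesgue) = c0 * \<delta> ^ CARD('d)"
    using kern_integral by blast
  define c where "c = (\<integral>y. kern \<delta> (\<lambda>_. 0) x y \<partial>lebesgue)"
  have c: "c > 0" using c0 \<delta> by (simp add: c_def)
  have "\<bar>conv F \<delta> (\<lambda>_. 0) x - q * c\<bar> = \<bar>\<integral>y. (F y - q) * kern \<delta> (\<lambda>_. 0) x y \<partial>lebesgue\<bar>"
    unfolding c_def conv_minus_const(1)[OF F \<delta>] ..
  also have "\<dots> \<le> (\<integral>y. \<bar>(F y - q) * kern \<delta> (\<lambda>_. 0) x y\<bar> \<partial>lebesgue)" by (rule integral_abs_bound)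
  also have "\<dots> \<le> (\<integral>y. r * kern \<delta> (\<lambda>_. 0) x y \<partial>lebesgue)"
  proof (rule integral_mono_AE)
    show "AE y in lebesgue. \<bar>(F y - q) * kern \<delta> (\<lambda>_. 0) x y\<bar> \<le> r * kern \<delta> (\<lambda>_. 0) x y"
      using near
    proof eventually_elim
      case (elim y)
      show ?case
      proof (cases "kern \<delta> (\<lambda>_. 0) x y = 0")
        case False
        then have "\<bar>F y - q\<bar> \<le> r" using elim kern_support[OF False \<delta>] by blast
        then show ?thesis using kern_nonneg[of \<delta> x y] by (simp add: abs_mult mult_right_mono)
      qed simp
    qed
  qed (auto simp: conv_minus_const(2)[OF F \<delta>] kern_integrable[OF \<delta>])
  also have "\<dots> = r * c" by (simp add: c_def)
  finally have "\<bar>conv F \<delta> (\<lambda>_. 0) x - q * c\<bar> \<le> r * c" .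
  moreover have "mollify F \<delta> x - q = (conv F \<delta> (\<lambda>_. 0) x - q * c) / c"
    using c by (simp add: mollify_def c_def diff_divide_distrib)
  ultimately show ?thesis using c by (simp add: abs_divide pos_divide_le_eq)
qed

text \<open>The differentiation theorem for integrals describes its cubes by \<open>One\<close>;
  this makes membership in them a condition on coordinates.\<close>

lemma One_cart: "(One :: real^'d::finite) = 1"
proof (rule vec_eq_iff[THEN iffD2], rule allI)
  fix i :: 'd
  have "(One :: real^'d) $ i = (One :: real^'d) \<bullet> axis i 1" by (rule cart_eq_inner_axis)
  also have "\<dots> = (\<Sum>b\<in>(Basis :: (real^'d) set). if b = axis i 1 then 1 else 0)"
    unfolding inner_sum_left by (intro sum.cong) (auto simp: inner_Basis)
  also have "\<dots> = 1" by (simp add: axis_in_Basis_iff)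
  finally show "(One :: real^'d) $ i = 1 $ i" by simp
qed

lemma mollify_tendsto_AE:
  fixes F :: "real^'d::finite \<Rightarrow> real"
  assumes F: "integrable lebesgue F"
  obtains N where "negligible N" "\<And>x. x \<notin> N \<Longrightarrow> ((\<lambda>\<delta>. mollify F \<delta> x) \<longlongrightarrow> F x) (at_right 0)"
proof -
  \<comment> \<open>Differentiating the integrals of \<open>\<bar>F - q\<bar>\<close> for all rational \<open>q\<close> makes almost every point a
    Lebesgue point, at which averages with respect to any bounded kernel converge.\<close>
  have si: "set_integrable lebesgue (cbox a b) (\<lambda>y. \<bar>F y - q\<bar>)" for a b q
  proof -
    have "set_integrable lebesgue (cbox a b) F"
      unfolding set_integrable_def using integrable_mult_indicator[OF _ F, of "cbox a b"] by simp
    moreover have "set_integrable lebesgue (cbox a b) (\<lambda>_. q)"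
      by (intro absolutely_integrable_continuous continuous_intros)
    ultimately show ?thesis by (intro set_integrable_abs set_integral_diff)
  qed
  have "\<exists>N. negligible N \<and> (\<forall>x e. x \<notin> N \<longrightarrow> 0 < e \<longrightarrow> (\<exists>d>0. \<forall>h. 0 < h \<and> h < d \<longrightarrow>
    norm (integral (cbox x (x + h *\<^sub>R One)) (\<lambda>y. \<bar>F y - q\<bar>) /\<^sub>R h ^ DIM(real^'d) - \<bar>F x - q\<bar>) < e))" for q
    by (rule integrable_ccontinuous_explicit[of "\<lambda>y. \<bar>F y - q\<bar>"])
      (use si set_lebesgue_integral_eq_integral(1) in blast)+
  then obtain N where N: "\<And>q. negligible (N q)"
    "\<And>q x e. x \<notin> N q \<Longrightarrow> 0 < e \<Longrightarrow> (\<exists>d>0. \<forall>h. 0 < h \<and> h < d \<longrightarrow>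
    norm (integral (cbox x (x + h *\<^sub>R One)) (\<lambda>y. \<bar>F y - q\<bar>) /\<^sub>R h ^ DIM(real^'d) - \<bar>F x - q\<bar>) < e)"
    by metis
  obtain M where M: "M > 0" "\<And>\<delta> (x :: real^'d) y. \<bar>kern \<delta> (\<lambda>_. 0) x y\<bar> \<le> M" by (rule kern_bounded) blast
  obtain c0 where c0: "c0 > 0" "\<And>\<delta> (x :: real^'d). \<delta> > 0 \<Longrightarrow> (\<integral>y. kern \<delta> (\<lambda>_. 0) x y \<partial>lebesgue) = c0 * \<delta> ^ CARD('d)"
    using kern_integral by blast
  show thesis
  proof (rule that[of "\<Union>(N ` \<rat>)"])
    show "negligible (\<Union>(N ` \<rat>))"
      by (rule negligible_countable_Union) (use N countable_rat in auto)
    fix x assume x: "x \<notin> \<Union>(N ` \<rat>)"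
    show "((\<lambda>\<delta>. mollify F \<delta> x) \<longlongrightarrow> F x) (at_right 0)"
    proof (rule tendstoI)
      fix e :: real assume e: "e > 0"
      \<comment> \<open>Near \<open>x\<close> the average of \<open>\<bar>F y - q\<bar>\<close> is
        below \<open>2 * e'\<close>, so the mollification is within \<open>2 * M / c0 * e'\<close>
        of \<open>q\<close>, and \<open>q\<close> is within \<open>e'\<close> of \<open>F x\<close>;
        together this is \<open>e\<close>.\<close>
      define e' where "e' = e / (2 * M / c0 + 1)"
      have K: "2 * M / c0 + 1 > 0" using M c0 by (simp add: add_pos_pos)
      have e': "e' > 0" "(2 * M / c0 + 1) * e' = e" using e K by (auto simp: e'_def)
      obtain q where q: "q \<in> \<rat>" "F x - e' < q" "q < F x + e'"
        using Rats_dense_in_real[of "F x - e'" "F x + e'"] e' by auto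
      then have qx: "\<bar>F x - q\<bar> < e'" by auto
      obtain d where d: "d > 0" "\<And>h. 0 < h \<Longrightarrow> h < d \<Longrightarrow>
        norm (integral (cbox x (x + h *\<^sub>R One)) (\<lambda>y. \<bar>F y - q\<bar>) /\<^sub>R h ^ DIM(real^'d) - \<bar>F x - q\<bar>) < e'"
        using N(2)[of x q e'] x q(1) e'(1) by blast
      have "dist (mollify F h x) (F x) < e" if h: "0 < h" "h < d" for h
      proof -
        define J where "J = integral (cbox x (x + h *\<^sub>R One)) (\<lambda>y. \<bar>F y - q\<bar>)"
        define c where "c = (\<integral>y. kern h (\<lambda>_. 0) x y \<partial>lebesgue)"
        have c: "c = c0 * h ^ CARD('d)" using c0 h by (simp add: c_def)
        have hd: "h ^ CARD('d) > 0" using h by simp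
        have "\<bar>J / h ^ CARD('d) - \<bar>F x - q\<bar>\<bar> < e'"
          using d(2)[OF h] by (simp add: J_def divide_inverse mult.commute)
        then have "J / h ^ CARD('d) < 2 * e'" using qx by linarith
        then have J: "J < 2 * e' * h ^ CARD('d)" using hd by (simp add: pos_divide_less_eq)
        have "\<bar>conv F h (\<lambda>_. 0) x - q * c\<bar> = \<bar>\<integral>y. (F y - q) * kern h (\<lambda>_. 0) x y \<partial>lebesgue\<bar>"
          unfolding c_def conv_minus_const(1)[OF F h(1)] ..
        also have "\<dots> \<le> (\<integral>y. M * (indicator (cbox x (x + h *\<^sub>R One)) y *\<^sub>R \<bar>F y - q\<bar>) \<partial>lebesgue)"
        proof (rule integral_abs_bound_integral)
          show "integrable lebesgue (\<lambda>y. M * (indicator (cbox x (x + h *\<^sub>R One)) y *\<^sub>R \<bar>F y - q\<bar>))"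
            using si[of x "x + h *\<^sub>R One" q] unfolding set_integrable_def by (intro integrable_mult_right) auto
          fix y
          show "\<bar>(F y - q) * kern h (\<lambda>_. 0) x y\<bar> \<le> M * (indicator (cbox x (x + h *\<^sub>R One)) y *\<^sub>R \<bar>F y - q\<bar>)"
          proof (cases "kern h (\<lambda>_. 0) x y = 0")
            case True
            then show ?thesis using M by (simp add: indicator_def)
          next
            case False
            have "y \<in> cbox x (x + h *\<^sub>R One)"
              using kern_support[OF False h(1)] by (auto simp: One_cart mem_box_cart less_imp_le)
            then show ?thesis using M(2)[of h x y] by (simp add: abs_mult mult.commute[of M] mult_left_mono)
          qed
        qed (rule conv_minus_const(2)[OF F h(1)])
        also have "\<dots> = M * J"
          using set_lebesgue_integral_eq_integral(2)[OF si[of x "x + h *\<^sub>R One" q]]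
          by (simp add: J_def set_lebesgue_integral_def)
        also have "\<dots> < M * (2 * e' * h ^ CARD('d))" using J M by simp
        finally have "\<bar>conv F h (\<lambda>_. 0) x - q * c\<bar> < (2 * M / c0 * e') * c"
          using c0 by (simp add: c)
        moreover have c_pos: "c > 0" using c c0 hd by simp
        moreover have "mollify F h x - q = (conv F h (\<lambda>_. 0) x - q * c) / c"
          using c_pos by (simp add: mollify_def c_def diff_divide_distrib)
        ultimately have "\<bar>mollify F h x - q\<bar> < 2 * M / c0 * e'"
          by (simp add: abs_divide pos_divide_less_eq)
        moreover have "2 * M / c0 * e' + e' = e" using e'(2) by (simp add: ring_distribs)
        ultimately show ?thesis using qx unfolding dist_real_def by linarith
      qed
      then show "\<forall>\<^sub>F \<delta> in at_right 0. dist (mollify F \<delta> x) (F x) < e"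
        unfolding eventually_at_right_field using d(1) by blast
    qed
  qed
qed

section \<open>The Lipschitz representative\<close>

lemma l1_nonneg: "l1 x \<ge> 0"
  by (simp add: l1_def sum_nonneg)

lemma l1_triangle: "l1 (x - z) \<le> l1 (x - y) + l1 (y - z)"
  unfolding l1_def sum.distrib[symmetric] by (intro sum_mono) auto

lemma l1_commute: "l1 (x - y) = l1 (y - x)"
  unfolding l1_def by (intro sum.cong) auto

lemma l1_le_norm: "l1 (x :: real^'d::finite) \<le> real CARD('d) * norm x"
  unfolding l1_def using sum_bounded_above[of UNIV "\<lambda>i. \<bar>x $ i\<bar>" "norm x"] component_le_norm_cart by auto

lemma l1_lipschitz_imp_continuous:
  assumes "\<And>x y. \<bar>g x - g y\<bar> \<le> l1 (x - y :: real^'d::finite)"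
  shows "continuous_on S g"
proof -
  have "(real CARD('d))-lipschitz_on S g"
    by (rule lipschitz_onI) (use assms l1_le_norm order.trans in \<open>auto simp: dist_norm, blast\<close>)
  then show ?thesis by (rule lipschitz_on_continuous_on)
qed

lemma lipschitz_extension_l1:
  fixes f :: "real^'d::finite \<Rightarrow> real"
  assumes ne: "E \<noteq> {}" and lip: "\<And>x y. x \<in> E \<Longrightarrow> y \<in> E \<Longrightarrow> \<bar>f x - f y\<bar> \<le> l1 (x - y)"
  obtains g where "\<And>x y. \<bar>g x - g y\<bar> \<le> l1 (x - y)" "\<And>x. x \<in> E \<Longrightarrow> g x = f x"
proof -
  \<comment> \<open>McShane's formula\<close>
  define g where "g x = (INF y\<in>E. f y + l1 (x - y))" for x
  obtain z where z: "z \<in> E" using ne by blast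
  have lower: "f z - l1 (x - z) \<le> f y + l1 (x - y)" if "y \<in> E" "z \<in> E" for x y z
    using lip[OF that(2,1)] l1_triangle[of z y x] by (simp add: l1_commute[of z x])
  have bdd: "bdd_below ((\<lambda>y. f y + l1 (x - y)) ` E)" for x
    using lower[OF _ z] by (intro bdd_belowI2) blast
  have upper: "g x \<le> f y + l1 (x - y)" if "y \<in> E" for x y
    unfolding g_def by (intro cINF_lower bdd that)
  have one: "g x \<le> g x' + l1 (x - x')" for x x'
  proof -
    have "g x - l1 (x - x') \<le> f y + l1 (x' - y)" if "y \<in> E" for y
      using upper[OF that, of x] l1_triangle[of x y x'] by linarith
    then have "g x - l1 (x - x') \<le> g x'" unfolding g_def[of x'] by (intro cINF_greatest ne)
    then show ?thesis by simp
  qed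
  show thesis
  proof (rule that[of g])
    show "\<bar>g x - g y\<bar> \<le> l1 (x - y)" for x y
      using one[of x y] one[of y x] l1_commute[of x y] by (simp add: abs_le_iff)
    fix x assume x: "x \<in> E"
    have l0: "l1 (x - x) = 0" by (simp add: l1_def)
    have "f x \<le> f y + l1 (x - y)" if "y \<in> E" for y using lower[OF that x, of x] l0 by simp
    then have "f x \<le> g x" unfolding g_def by (intro cINF_greatest ne)
    then show "g x = f x" using upper[OF x, of x] l0 by simp
  qed
qed

text \<open>Passing to the limit gives the Lipschitz bound only off a null set of the open cube. The
  extension supplies values on the exceptional set and on the boundary, where the representative has
  to be continuous as well.\<close>

lemma lipschitz_representative:
  fixes f :: "real^'d::finite \<Rightarrow> real"
  defines "F \<equiv> \<lambda>y. indicator (box 0 1) y * f y"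
  assumes F: "integrable lebesgue F" and wd: "weak_derivs_bounded 1 f"
  obtains g where "\<And>x y. \<bar>g x - g y\<bar> \<le> l1 (x - y)"
    "AE x in lebesgue. x \<in> box 0 1 \<longrightarrow> g x = f x"
proof -
  obtain N where N: "negligible N" "\<And>x. x \<notin> N \<Longrightarrow> ((\<lambda>\<delta>. mollify F \<delta> x) \<longlongrightarrow> F x) (at_right 0)"
    using mollify_tendsto_AE[OF F] by blast
  have ev: "\<forall>\<^sub>F \<delta> in at_right 0. x \<in> inner_cube \<delta>" if x: "x \<in> box 0 1" for x :: "real^'d"
  proof -
    have "\<forall>\<^sub>F \<delta> in at_right 0. x $ j + \<delta> < 1" for j
      by (rule order_tendstoD(2)[of _ "x $ j + 0"]) (use x in \<open>auto intro!: tendsto_eq_intros simp: mem_box_cart\<close>)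
    then have "\<forall>\<^sub>F \<delta> in at_right 0. \<forall>j. x $ j + \<delta> < 1" by (rule eventually_all_finite)
    then show ?thesis by eventually_elim (use x in \<open>auto simp: inner_cube_def mem_box_cart\<close>)
  qed
  have lip: "\<bar>f x - f y\<bar> \<le> l1 (x - y)" if x: "x \<in> box 0 1 - N" and y: "y \<in> box 0 1 - N" for x y
  proof -
    have "((\<lambda>\<delta>. \<bar>mollify F \<delta> x - mollify F \<delta> y\<bar>) \<longlongrightarrow> \<bar>F x - F y\<bar>) (at_right 0)"
      using x y by (intro tendsto_intros N) auto
    moreover have "\<forall>\<^sub>F \<delta> in at_right 0. \<bar>mollify F \<delta> x - mollify F \<delta> y\<bar> \<le> l1 (x - y)"
      using ev[of x] ev[of y] eventually_at_right_less[of "0::real"]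
      by (rule eventually_elim2[OF eventually_conj]) (use x y in blast, use x y in blast,
          use mollify_lipschitz[of f] F wd in \<open>auto simp: F_def\<close>)
    ultimately have "\<bar>F x - F y\<bar> \<le> l1 (x - y)"
      by (rule tendsto_upperbound) auto
    then show ?thesis using x y by (simp add: F_def)
  qed
  have "box 0 1 - N \<noteq> {}"
  proof
    assume "box 0 1 - N = {}"
    then have "negligible (box 0 (1 :: real^'d))" using N(1) negligible_subset by blast
    then show False by (simp add: negligible_interval interval_eq_empty_cart)
  qed
  from lipschitz_extension_l1[OF this lip] obtain g where
    g: "\<And>x y. \<bar>g x - g y\<bar> \<le> l1 (x - y)" "\<And>x. x \<in> box 0 1 - N \<Longrightarrow> g x = f x" by blast
  have "AE x in lebesgue. x \<notin> N"
    using N(1) by (auto simp: negligible_iff_null_sets intro: AE_not_in)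
  then have "AE x in lebesgue. x \<in> box 0 1 \<longrightarrow> g x = f x"
    by eventually_elim (use g in auto)
  with g(1) show thesis by (rule that)
qed

text \<open>The Taylor polynomials live in contracted coordinates centred at a grid point, while all
  grid points share the monomials in \<open>x\<close> computed by the network; this lemma translates
  between the two.\<close>

lemma affine_monomial_expansion:
  fixes b :: "real^'d::finite"
  shows "length ks \<le> n \<Longrightarrow> \<exists>c. \<forall>x. monomial ks (s *\<^sub>R x + b) = (\<Sum>js | length js \<le> n. c js * monomial js x)"
proof (induction ks arbitrary: n)
  case Nil
  have "(\<Sum>js | length js \<le> n. (if js = [] then 1 else 0) * monomial js x) = 1" for x :: "real^'d"
    by (subst sum.remove[OF finite_lists_le, of "[]"]) (auto simp: monomial_Nil intro!: sum.neutral)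
  then show ?case by (intro exI[of _ "\<lambda>js. if js = [] then 1 else 0"]) (simp add: monomial_Nil)
next
  case (Cons i ks)
  then obtain m where m: "n = Suc m" "length ks \<le> m" by (cases n) auto
  obtain c where c: "\<And>x. monomial ks (s *\<^sub>R x + b) = (\<Sum>js | length js \<le> m. c js * monomial js x)"
    using Cons.IH[OF m(2)] by blast
  \<comment> \<open>The new factor is \<open>s * x $ i + b $ i\<close>: \<open>c1\<close> collects
    the products with \<open>b $ i\<close>, which keep the list, and \<open>c2\<close> those with
    \<open>s * x $ i\<close>, which put \<open>i\<close> in front of it.\<close>
  define c1 where "c1 js = (if length js \<le> m then b $ i * c js else 0)" for js
  define c2 where "c2 js = (case js of [] \<Rightarrow> 0 | j # is \<Rightarrow> if j = i then s * c is else 0)" for js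
  have 1: "(\<Sum>js | length js \<le> n. c1 js * monomial js x) = b $ i * (\<Sum>js | length js \<le> m. c js * monomial js x)" for x
  proof -
    have "(\<Sum>js | length js \<le> n. c1 js * monomial js x) = (\<Sum>js | length js \<le> m. c1 js * monomial js x)"
      by (rule sum.mono_neutral_right[OF finite_lists_le]) (auto simp: m c1_def)
    then show ?thesis by (simp add: c1_def sum_distrib_left mult.assoc)
  qed
  have 2: "(\<Sum>js | length js \<le> n. c2 js * monomial js x) = s * x $ i * (\<Sum>js | length js \<le> m. c js * monomial js x)" for x
  proof -
    have "(\<Sum>js | length js \<le> n. c2 js * monomial js x) = (\<Sum>js \<in> (#) i ` {js. length js \<le> m}. c2 js * monomial js x)"
    proof (rule sum.mono_neutral_right[OF finite_lists_le])
      show "(#) i ` {js. length js \<le> m} \<subseteq> {js. length js \<le> n}" by (auto simp: m)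
      show "\<forall>js\<in>{js. length js \<le> n} - (#) i ` {js. length js \<le> m}. c2 js * monomial js x = 0"
        by (auto simp: m c2_def split: list.splits)
    qed
    also have "\<dots> = (\<Sum>js | length js \<le> m. s * c js * (x $ i * monomial js x))"
      by (subst sum.reindex) (auto simp: c2_def monomial_Cons)
    finally show ?thesis by (simp add: sum_distrib_left mult_ac)
  qed
  have "monomial (i # ks) (s *\<^sub>R x + b) = (\<Sum>js | length js \<le> n. (c1 js + c2 js) * monomial js x)" for x
    unfolding ring_distribs sum.distrib 1 2 monomial_Cons c by (simp add: algebra_simps)
  then show ?case by (intro exI[of _ "\<lambda>js. c1 js + c2 js"]) blast
qed

lemma taylor_polynomial_expansion:
  fixes b :: "real^'d::finite"
  shows "\<exists>c. \<forall>x. (\<Sum>k<n. (\<Sum>ks | length ks = k. monomial ks (s *\<^sub>R x + b) * C ks) / fact k) / Z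
    = (\<Sum>js | length js \<le> n. c js * monomial js x)"
proof -
  have "\<forall>ks. \<exists>c. length ks \<le> n \<longrightarrow> (\<forall>x. monomial ks (s *\<^sub>R x + b) = (\<Sum>js | length js \<le> n. c js * monomial js x))"
    using affine_monomial_expansion by metis
  then obtain c where c: "\<And>ks x. length ks \<le> n \<Longrightarrow> monomial ks (s *\<^sub>R x + b) = (\<Sum>js | length js \<le> n. c ks js * monomial js x)"
    by metis
  define c' where "c' js = (\<Sum>k<n. \<Sum>ks | length ks = k. c ks js * C ks / fact (length ks) / Z)" for js
  have "(\<Sum>k<n. (\<Sum>ks | length ks = k. monomial ks (s *\<^sub>R x + b) * C ks) / fact k) / Z
      = (\<Sum>js | length js \<le> n. c' js * monomial js x)" for x
  proof -
    have summand: "monomial ks (s *\<^sub>R x + b) * C ks / fact (length ks) / Z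
        = (\<Sum>js | length js \<le> n. c ks js * C ks / fact (length ks) / Z * monomial js x)"
      if "length ks < n" for ks
    proof -
      have "monomial ks (s *\<^sub>R x + b) * C ks / fact (length ks) / Z
          = (C ks / fact (length ks) / Z) * (\<Sum>js | length js \<le> n. c ks js * monomial js x)"
        using that by (simp add: c)
      then show ?thesis by (simp add: sum_distrib_left mult_ac)
    qed
    have "(\<Sum>k<n. (\<Sum>ks | length ks = k. monomial ks (s *\<^sub>R x + b) * C ks) / fact k) / Z
        = (\<Sum>k<n. \<Sum>ks | length ks = k. monomial ks (s *\<^sub>R x + b) * C ks / fact (length ks) / Z)"
      by (simp add: sum_divide_distrib)
    also have "\<dots> = (\<Sum>k<n. \<Sum>ks | length ks = k. \<Sum>js | length js \<le> n.
        c ks js * C ks / fact (length ks) / Z * monomial js x)"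
      by (intro sum.cong refl summand) auto
    also have "\<dots> = (\<Sum>k<n. \<Sum>js | length js \<le> n. \<Sum>ks | length ks = k.
        c ks js * C ks / fact (length ks) / Z * monomial js x)"
      by (intro sum.cong refl sum.swap)
    also have "\<dots> = (\<Sum>js | length js \<le> n. \<Sum>k<n. \<Sum>ks | length ks = k.
        c ks js * C ks / fact (length ks) / Z * monomial js x)"
      by (rule sum.swap)
    finally show ?thesis by (simp add: c'_def sum_distrib_right)
  qed
  then show ?thesis by blast
qed

section \<open>The approximating network\<close>

text \<open>\<open>Max\<close> in \<open>sobolev_norm\<close> bounds its elements only if the set is
  finite.\<close>

lemma finite_mi_order_le: "finite {k :: nat^'d::finite. mi_order k \<le> n}"
proof -
  have "{k :: nat^'d. mi_order k \<le> n} \<subseteq> vec_lambda ` (UNIV \<rightarrow>\<^sub>E {..n})"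
  proof
    fix k :: "nat^'d" assume "k \<in> {k. mi_order k \<le> n}"
    then have "k $ i \<le> n" for i
      using member_le_sum[of i UNIV "($) k"] by (simp add: mi_order_def)
    then have "k = vec_lambda (($) k)" "($) k \<in> UNIV \<rightarrow>\<^sub>E {..n}" by auto
    then show "k \<in> vec_lambda ` (UNIV \<rightarrow>\<^sub>E {..n})" by blast
  qed
  then show ?thesis by (rule finite_subset) (intro finite_imageI finite_PiE; simp)
qed

lemma AE_lebesgue_on_unit_cube:
  "(AE x in lebesgue_on unit_cube. P x) \<longleftrightarrow> (AE x in lebesgue. x \<in> (unit_cube :: (real^'d::finite) set) \<longrightarrow> P x)"
  by (rule AE_restrict_space_iff) auto

text \<open>A finite bound rules out the branch with value \<open>\<infinity>\<close>; measurability
  comes from there.\<close>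

lemma Linf_norm_boundD:
  fixes f :: "real^'d::finite \<Rightarrow> real"
  assumes "Linf_norm f \<le> ereal K"
  shows "f \<in> borel_measurable (lebesgue_on unit_cube)" "AE x in lebesgue. x \<in> unit_cube \<longrightarrow> \<bar>f x\<bar> \<le> K"
proof -
  show m: "f \<in> borel_measurable (lebesgue_on unit_cube)"
    using assms unfolding Linf_norm_def by (auto split: if_splits)
  have "AE x in lebesgue_on unit_cube. ereal \<bar>f x\<bar> \<le> esssup (lebesgue_on unit_cube) (\<lambda>x. ereal \<bar>f x\<bar>)"
    by (rule esssup_AE)
  then have "AE x in lebesgue_on unit_cube. \<bar>f x\<bar> \<le> K"
    by eventually_elim (use assms m order.trans in \<open>fastforce simp: Linf_norm_def\<close>)
  then show "AE x in lebesgue. x \<in> unit_cube \<longrightarrow> \<bar>f x\<bar> \<le> K"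
    by (simp only: AE_lebesgue_on_unit_cube)
qed

lemma sobolev_ball_integrable:
  fixes f :: "real^'d::finite \<Rightarrow> real"
  assumes "f \<in> sobolev_ball n"
  shows "integrable lebesgue (\<lambda>y. indicator (box 0 1) y * f y)"
proof -
  \<comment> \<open>\<open>sobolev_norm\<close> concerns a chosen weak derivative of order 0 and not
    \<open>f\<close> itself, so boundedness of \<open>f\<close> is taken from membership in the
    space.\<close>
  have "Linf_norm f < \<infinity>" using assms by (simp add: sobolev_ball_def sobolev_space_def)
  then obtain K :: nat where "Linf_norm f < ereal (real K)" using less_PInf_Ex_of_nat[of "Linf_norm f"] by auto
  then have K: "Linf_norm f \<le> ereal (real K)" by simp
  have "integrable (lebesgue_on unit_cube) f"
  proof (rule Bochner_Integration.integrable_bound)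
    show "integrable (lebesgue_on (unit_cube :: (real^'d) set)) (\<lambda>_. real K)"
      by (intro finite_measure.integrable_const finite_measure_lebesgue_on lmeasurable_cbox)
    show "AE x in lebesgue_on unit_cube. norm (f x) \<le> norm (real K)"
      using Linf_norm_boundD(2)[OF K] by (simp add: AE_lebesgue_on_unit_cube)
  qed (rule Linf_norm_boundD(1)[OF K])
  then have "set_integrable lebesgue unit_cube f"
    unfolding set_integrable_def by (subst (asm) integrable_restrict_space) auto
  then have "set_integrable lebesgue (box 0 1) f"
    by (rule set_integrable_subset) (auto simp: box_subset_cbox)
  then show ?thesis by (simp add: set_integrable_def)
qed

lemma sobolev_ball_weak_derivs_bounded:
  fixes f :: "real^'d::finite \<Rightarrow> real"
  assumes f: "f \<in> sobolev_ball n" and "m \<le> n"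
  shows "weak_derivs_bounded m f"
  unfolding weak_derivs_bounded_def
proof (intro allI impI exI conjI)
  fix k :: "nat^'d" assume k: "mi_order k = m"
  show "has_weak_deriv f k (weak_deriv f k)"
    unfolding weak_deriv_def using f k assms(2)
    by (intro someI_ex[of "has_weak_deriv f k"]) (auto simp: sobolev_ball_def sobolev_space_def)
  have "Linf_norm (weak_deriv f k) \<le> sobolev_norm n f"
    unfolding sobolev_norm_def using k assms(2) finite_mi_order_le by (intro Max_ge) auto
  also have "\<dots> \<le> 1" using f by (simp add: sobolev_ball_def)
  finally have "Linf_norm (weak_deriv f k) \<le> ereal 1" by (simp add: one_ereal_def)
  from Linf_norm_boundD(2)[OF this]
  show "AE y in lebesgue. y \<in> box 0 1 \<longrightarrow> \<bar>weak_deriv f k y\<bar> \<le> 1"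
    by eventually_elim (use box_subset_cbox in blast)
qed

lemma AE_not_boundary_unit_cube: "AE x in lebesgue. x \<in> unit_cube \<longrightarrow> x \<in> box 0 (1 :: real^'d::finite)"
proof -
  have "unit_cube - box 0 (1 :: real^'d) \<in> null_sets lebesgue"
    using negligible_frontier_interval[of 0 "1 :: real^'d"] by (simp add: negligible_iff_null_sets)
  from AE_not_in[OF this] show ?thesis by eventually_elim auto
qed

text \<open>The representative is fixed before \<eta> and \<open>a\<close>, while the coefficients
  depend on both through the scale of the mollification. The additive \<eta> accounts for replacing
  \<open>g x\<close> by the mollification at a nearby point.\<close>

lemma sobolev_polynomial_approximation:
  fixes f :: "real^'d::finite \<Rightarrow> real"
  assumes f: "f \<in> sobolev_ball n" and n: "n \<ge> 1"
  obtains g where "continuous_representative f g"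
    "\<And>\<eta> a. \<eta> > 0 \<Longrightarrow> a \<in> unit_cube \<Longrightarrow> \<exists>c. \<forall>x\<in>unit_cube.
      \<bar>g x - (\<Sum>ks | length ks \<le> n. c ks * monomial ks x)\<bar> \<le> l1 (x - a) ^ n + \<eta>"
proof -
  define F where "F = (\<lambda>y. indicator (box 0 1) y * f y)"
  have F: "integrable lebesgue F" unfolding F_def by (rule sobolev_ball_integrable[OF f])
  obtain g where g: "\<And>x y. \<bar>g x - g y\<bar> \<le> l1 (x - y)" "AE x in lebesgue. x \<in> box 0 1 \<longrightarrow> g x = f x"
    by (rule lipschitz_representative[OF F[unfolded F_def] sobolev_ball_weak_derivs_bounded[OF f n]]) blast
  have "AE x in lebesgue. x \<in> unit_cube \<longrightarrow> g x = f x"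
    using g(2) AE_not_boundary_unit_cube by eventually_elim blast
  then have rep: "continuous_representative f g"
    unfolding continuous_representative_def AE_lebesgue_on_unit_cube
    using l1_lipschitz_imp_continuous[OF g(1)] by blast
  show thesis
  proof (rule that[OF rep])
    fix \<eta> :: real and a :: "real^'d" assume \<eta>: "\<eta> > 0" and a: "a \<in> unit_cube"
    \<comment> \<open>The bound 1 / 6 keeps the contraction factor at least 1 / 2; the other one
      makes a displacement by \<open>2 * \<delta>\<close> in every coordinate cost at most
      \<eta>.\<close>
    define \<delta> where "\<delta> = min (1 / 6) (\<eta> / (2 * real CARD('d)))"
    have d: "real CARD('d) > 0" by simp
    have \<delta>: "\<delta> > 0" "\<delta> \<le> 1 / 6" using \<eta> d by (auto simp: \<delta>_def)
    have \<delta>\<eta>: "real CARD('d) * (2 * \<delta>) \<le> \<eta>"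
    proof -
      have "\<delta> \<le> \<eta> / (2 * real CARD('d))" by (simp add: \<delta>_def)
      then show ?thesis using d by (simp add: pos_le_divide_eq mult_ac)
    qed
    \<comment> \<open>With the shift by \<delta> this maps [0, 1] onto [\<delta>, 1 - 2 \<delta>],
      so a kernel cube of side \<delta> attached there still keeps distance \<delta> from the
      boundary.\<close>
    define s where "s = 1 - 3 * \<delta>"
    have s: "0 \<le> s" "s \<le> 1" using \<delta> by (auto simp: s_def)
    \<comment> \<open>The mollification at scale \<open>\<delta>\<close> is only controlled on \<open>inner_cube \<delta>\<close>, so the cube is first
      contracted into it.\<close>
    define \<theta> :: "real^'d \<Rightarrow> real^'d" where "\<theta> x = s *\<^sub>R x + (\<chi> i. \<delta>)" for x
    have \<theta>: "\<theta> x $ j - x $ j \<in> {- 2 * \<delta>..\<delta>}" "\<delta> \<le> \<theta> x $ j" "\<theta> x $ j \<le> 1 - 2 * \<delta>" if "x \<in> unit_cube" for x j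
    proof -
      have "0 \<le> x $ j" "x $ j \<le> 1" using that by (auto simp: mem_box_cart)
      then have "0 \<le> \<delta> * x $ j" "\<delta> * x $ j \<le> \<delta>" "0 \<le> s * x $ j" "s * x $ j \<le> s"
        using \<delta> s by (auto intro: mult_left_le)
      then show "\<theta> x $ j - x $ j \<in> {- 2 * \<delta>..\<delta>}" "\<delta> \<le> \<theta> x $ j" "\<theta> x $ j \<le> 1 - 2 * \<delta>"
        by (auto simp: \<theta>_def s_def algebra_simps)
    qed
    have inner: "\<theta> x \<in> inner_cube \<delta>" if "x \<in> unit_cube" for x
      unfolding inner_cube_def
    proof (intro CollectI allI conjI)
      show "0 < \<theta> x $ j" "\<theta> x $ j + \<delta> < 1" for j using \<theta>(2,3)[OF that, of j] \<delta> by linarith+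
    qed
    obtain c0 where c0: "\<And>\<delta> (x :: real^'d). \<delta> > 0 \<Longrightarrow> (\<integral>y. kern \<delta> (\<lambda>_. 0) x y \<partial>lebesgue) = c0 * \<delta> ^ CARD('d)"
      using kern_integral by blast
    obtain c where c: "\<And>x. (\<Sum>k<n. (\<Sum>ks | length ks = k. monomial ks (s *\<^sub>R x + ((\<chi> i. \<delta>) - \<theta> a)) * taylor_coeff F \<delta> (\<theta> a) ks) / fact k) / (c0 * \<delta> ^ CARD('d))
        = (\<Sum>js | length js \<le> n. c js * monomial js x)"
      using taylor_polynomial_expansion[where n = n and s = s and b = "(\<chi> i. \<delta>) - \<theta> a"] by metis
    have "\<bar>g x - (\<Sum>ks | length ks \<le> n. c ks * monomial ks x)\<bar> \<le> l1 (x - a) ^ n + \<eta>" if x: "x \<in> unit_cube" for x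
    proof -
      have eq: "s *\<^sub>R x + ((\<chi> i. \<delta>) - \<theta> a) = \<theta> x - \<theta> a" by (simp add: \<theta>_def)
      have "\<bar>mollify F \<delta> (\<theta> x) - (\<Sum>ks | length ks \<le> n. c ks * monomial ks x)\<bar> \<le> l1 (\<theta> x - \<theta> a) ^ n"
        using mollify_taylor[OF F[unfolded F_def] sobolev_ball_weak_derivs_bounded[OF f order.refl] _ \<delta>(1) inner[OF a] inner[OF x]] n
        unfolding c0[OF \<delta>(1)] c[symmetric] eq F_def by simp
      also have "l1 (\<theta> x - \<theta> a) ^ n \<le> l1 (x - a) ^ n"
      proof (intro power_mono l1_nonneg)
        have "l1 (\<theta> x - \<theta> a) = s * l1 (x - a)"
          using s by (simp add: l1_def \<theta>_def sum_distrib_left abs_mult flip: right_diff_distrib)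
        then show "l1 (\<theta> x - \<theta> a) \<le> l1 (x - a)" using s l1_nonneg[of "x - a"] by (simp add: mult_left_le_one_le)
      qed
      finally have 1: "\<bar>mollify F \<delta> (\<theta> x) - (\<Sum>ks | length ks \<le> n. c ks * monomial ks x)\<bar> \<le> l1 (x - a) ^ n" .
      \<comment> \<open>The mollification averages values of \<open>g\<close> at points
        \<open>y\<close> which differ from \<open>x\<close> by at most \<open>2 * \<delta>\<close>
        in each coordinate: \<theta> moves \<open>x\<close> by between -2 \<delta> and \<delta>, and
        the kernel adds between 0 and \<delta>.\<close>
      have 2: "\<bar>mollify F \<delta> (\<theta> x) - g x\<bar> \<le> \<eta>"
      proof (rule mollify_near[OF F \<delta>(1)])
        show "AE y in lebesgue. (\<forall>j. \<theta> x $ j < y $ j \<and> y $ j < \<theta> x $ j + \<delta>) \<longrightarrow> \<bar>F y - g x\<bar> \<le> \<eta>"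
          using g(2)
        proof (eventually_elim, intro impI)
          fix y assume y: "y \<in> box 0 1 \<longrightarrow> g y = f y" "\<forall>j. \<theta> x $ j < y $ j \<and> y $ j < \<theta> x $ j + \<delta>"
          have "0 < y $ j \<and> y $ j < 1" for j
            using y(2)[rule_format, of j] \<theta>(2,3)[OF x, of j] \<delta> by linarith
          then have "y \<in> box 0 1" by (simp add: mem_box_cart)
          then have "F y = g y" using y(1) by (simp add: F_def)
          moreover have "\<bar>(y - x) $ j\<bar> \<le> 2 * \<delta>" for j
            using y(2)[rule_format, of j] \<theta>(1)[OF x, of j] \<delta> by auto
          then have "l1 (y - x) \<le> real CARD('d) * (2 * \<delta>)"
            unfolding l1_def using sum_bounded_above[of UNIV "\<lambda>j. \<bar>(y - x) $ j\<bar>" "2 * \<delta>"] by simp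
          ultimately show "\<bar>F y - g x\<bar> \<le> \<eta>" using g(1)[of y x] \<delta>\<eta> by linarith
        qed
      qed
      show ?thesis using 1 2 by linarith
    qed
    then show "\<exists>c. \<forall>x\<in>unit_cube. \<bar>g x - (\<Sum>ks | length ks \<le> n. c ks * monomial ks x)\<bar> \<le> l1 (x - a) ^ n + \<eta>"
      by blast
  qed
qed

text \<open>The error is the weighted average of the local errors \<open>y - P m\<close>. Passing to
  \<open>z = real N *\<^sub>R x\<close> extracts the factor N^(-n), and \<eta> survives unchanged
  because the normalised weights sum to 1.\<close>

lemma shepard_error:
  fixes x :: "real^'d::finite" and P :: "real^'d \<Rightarrow> real"
  assumes K: "K \<ge> CARD('d) * (n + 1)" and N: "N > 0" and x: "x \<in> unit_cube"
    and P: "\<And>m. m \<in> grid N \<Longrightarrow> \<bar>y - P m\<bar> \<le> l1 (x - (1 / real N) *\<^sub>R m) ^ n + \<eta>"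
  shows "\<bar>y - (\<Sum>m\<in>grid N. shepard_weight K (real N *\<^sub>R x - m) * P m) /
      (\<Sum>m\<in>grid N. shepard_weight K (real N *\<^sub>R x - m))\<bar>
    \<le> 2 ^ (n * CARD('d)) * 6 ^ CARD('d) * (1 + real CARD('d)) ^ K / real N ^ n + \<eta>"
proof -
  define z where "z = real N *\<^sub>R x"
  define w where "w m = shepard_weight K (z - m)" for m
  define B where "B = (\<Sum>m\<in>grid N. w m)"
  define C where "C = 2 ^ (n * CARD('d)) * 6 ^ CARD('d) * (1 + real CARD('d)) ^ K"
  have B: "B > 0" unfolding B_def w_def by (rule sum_shepard_weight_pos)
  have w: "w m > 0" for m unfolding w_def by (rule shepard_weight_pos)
  have z: "0 \<le> z $ i" "z $ i \<le> real N" for i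
    using x by (auto simp: z_def mem_box_cart mult_left_le)
  have l: "l1 (x - (1 / real N) *\<^sub>R m) ^ n = l1 (z - m) ^ n / real N ^ n" for m
  proof -
    have "x - (1 / real N) *\<^sub>R m = (1 / real N) *\<^sub>R (z - m)" using N by (simp add: z_def algebra_simps)
    then have "l1 (x - (1 / real N) *\<^sub>R m) = l1 (z - m) / real N"
      by (simp add: l1_def sum_divide_distrib)
    then show ?thesis by (simp add: power_divide)
  qed
  have "\<bar>B * y - (\<Sum>m\<in>grid N. w m * P m)\<bar> = \<bar>\<Sum>m\<in>grid N. w m * (y - P m)\<bar>"
    by (simp add: B_def sum_distrib_right sum_subtractf right_diff_distrib)
  also have "\<dots> \<le> (\<Sum>m\<in>grid N. w m * (l1 (z - m) ^ n / real N ^ n + \<eta>))"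
    using P w unfolding l
    by (intro order.trans[OF sum_abs] sum_mono) (auto simp: abs_mult less_imp_le intro!: mult_mono)
  also have "\<dots> = (\<Sum>m\<in>grid N. w m * l1 (z - m) ^ n) / real N ^ n + B * \<eta>"
    by (simp add: B_def ring_distribs sum.distrib sum_divide_distrib sum_distrib_right)
  also have "\<dots> \<le> C * B / real N ^ n + B * \<eta>"
    unfolding w_def B_def C_def by (intro add_right_mono divide_right_mono sum_shepard_weight_times_power_le K z) simp
  also have "\<dots> = (C / real N ^ n + \<eta>) * B" by (simp add: algebra_simps)
  finally have "\<bar>B * y - (\<Sum>m\<in>grid N. w m * P m)\<bar> \<le> (C / real N ^ n + \<eta>) * B" .
  moreover have "y - (\<Sum>m\<in>grid N. w m * P m) / B = (B * y - (\<Sum>m\<in>grid N. w m * P m)) / B"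
    using B by (simp add: diff_divide_distrib)
  ultimately have "\<bar>y - (\<Sum>m\<in>grid N. w m * P m) / B\<bar> \<le> C / real N ^ n + \<eta>"
    using B by (simp add: abs_divide pos_divide_le_eq)
  then show ?thesis unfolding w_def B_def C_def z_def .
qed

text \<open>\<open>N\<close> is (2 C / \<epsilon>)^(1/n) rounded up. As \<epsilon> < 1, the power of
  \<epsilon> on the right is at least 1 and absorbs the additive 2 from rounding and from
  \<open>real N + 1\<close>.\<close>

lemma grid_resolution:
  fixes C :: real and n :: nat
  assumes C: "C > 0" and n: "n \<ge> 1" and e: "0 < \<epsilon>" "\<epsilon> < 1"
  obtains N :: nat where "N > 0" "C / real N ^ n \<le> \<epsilon> / 2"
    "real N + 1 \<le> ((2 * C) powr (1 / real n) + 2) * \<epsilon> powr (- (1 / real n))"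
proof -
  define r where "r = (2 * C / \<epsilon>) powr (1 / real n)"
  have r: "r > 0" using C e by (simp add: r_def)
  define N where "N = nat \<lceil>r\<rceil>"
  have N: "r \<le> real N" "real N \<le> r + 1" using r unfolding N_def by linarith+
  have "r ^ n = r powr real n" using r by (simp add: powr_realpow)
  also have "\<dots> = 2 * C / \<epsilon>" using C e n by (simp add: r_def powr_powr)
  finally have rn: "r ^ n = 2 * C / \<epsilon>" .
  have "C / real N ^ n \<le> C / r ^ n"
    using C N r by (intro divide_left_mono power_mono mult_pos_pos zero_less_power) auto
  also have "\<dots> = \<epsilon> / 2" using C e by (simp add: rn)
  finally have "C / real N ^ n \<le> \<epsilon> / 2" .
  moreover have "real N + 1 \<le> ((2 * C) powr (1 / real n) + 2) * \<epsilon> powr (- (1 / real n))"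
  proof -
    have "r = (2 * C) powr (1 / real n) * \<epsilon> powr (- (1 / real n))"
    proof -
      have "r = (2 * C) powr (1 / real n) / \<epsilon> powr (1 / real n)"
        unfolding r_def by (rule powr_divide)
      then show ?thesis by (simp add: powr_minus divide_inverse)
    qed
    moreover have "1 \<le> \<epsilon> powr (- (1 / real n))"
      using e by (simp add: powr_minus powr_le1 one_le_inverse_iff)
    ultimately show ?thesis using N by (simp add: ring_distribs)
  qed
  moreover have "N > 0" using N r by (cases N) auto
  ultimately show thesis using that by blast
qed

theorem theorem4p5:
  fixes n :: nat
  assumes "n \<ge> 1"
  shows "\<exists>S D :: real \<Rightarrow> real.
    S \<in> O[at_right 0](\<lambda>\<epsilon>. \<epsilon> powr (- (real CARD('d::finite) / real n)) * ln (ln (1 / \<epsilon>))) \<and>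
    D \<in> O[at_right 0](\<lambda>\<epsilon>. ln (ln (1 / \<epsilon>))) \<and>
    (\<forall>f \<in> (sobolev_ball n :: (real^'d \<Rightarrow> real) set).
      \<exists>g. continuous_representative f g \<and>
        (\<forall>\<epsilon>. 0 < \<epsilon> \<and> \<epsilon> < 1 \<longrightarrow>
          (\<exists>N :: 'd network. rational_network N \<and>
            real (network_size N) \<le> S \<epsilon> \<and>
            real (network_depth N) \<le> D \<epsilon> \<and>
            sup_norm (\<lambda>x. g x - network_fun N x) \<le> ereal \<epsilon>)))"
proof -
  \<comment> \<open>The exponent \<open>K\<close> of the weights has to be a power of 2 that is at
    least \<open>CARD('d) * (n + 1)\<close>; since k < 2^k, this \<open>q\<close> suffices.\<close>
  define q where "q = CARD('d) * (n + 1)"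
  define C where "C = 2 ^ (n * CARD('d)) * 6 ^ CARD('d) * (1 + real CARD('d)) ^ (2 ^ q)"
  define A where "A = (2 * C) powr (1 / real n) + 2"
  have C: "C > 0" unfolding C_def by (intro mult_pos_pos zero_less_power) auto
  have A: "A > 0" unfolding A_def using C by (intro add_nonneg_pos) auto
  have K: "CARD('d) * (n + 1) \<le> 2 ^ q" unfolding q_def using less_exp less_imp_le by blast
  obtain M D :: nat where net:
    "\<And>N (c :: real^'d \<Rightarrow> 'd list \<Rightarrow> real). \<exists>Net :: 'd network. rational_network Net \<and>
      network_size Net \<le> M * (N + 1) ^ CARD('d) \<and> network_depth Net \<le> D \<and>
      (\<forall>x\<in>unit_cube. network_fun Net x =
        (\<Sum>m\<in>grid N. shepard_weight (2 ^ q) (real N *\<^sub>R x - m) * (\<Sum>ks | length ks \<le> n. c m ks * monomial ks x))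
        / (\<Sum>m\<in>grid N. shepard_weight (2 ^ q) (real N *\<^sub>R x - m)))"
    by (rule shepard_network[where 'd = 'd and n = n and q = q]) blast
  define S where "S \<epsilon> = \<epsilon> powr (- (real CARD('d) / real n)) * (real M * A ^ CARD('d))" for \<epsilon>
  \<comment> \<open>The iterated logarithm tends to infinity as \<epsilon> tends to 0 from the
    right, so it dominates constants. This covers the constant depth bound as well as
    \<open>S\<close>, which consists of the power of \<epsilon> and a constant.\<close>
  have const: "(\<lambda>_. k) \<in> O[at_right 0](\<lambda>\<epsilon>::real. ln (ln (1 / \<epsilon>)))" for k :: real
    by real_asymp
  show ?thesis
  proof (rule exI[of _ S], rule exI[of _ "\<lambda>_. real D"], intro conjI ballI)
    show "S \<in> O[at_right 0](\<lambda>\<epsilon>. \<epsilon> powr (- (real CARD('d) / real n)) * ln (ln (1 / \<epsilon>)))"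
      unfolding S_def by (intro landau_o.big.mult landau_o.big_refl const)
    show "(\<lambda>_. real D) \<in> O[at_right 0](\<lambda>\<epsilon>. ln (ln (1 / \<epsilon>)))" by (rule const)
    fix f :: "real^'d \<Rightarrow> real" assume f: "f \<in> sobolev_ball n"
    obtain g where rep: "continuous_representative f g" and
      poly: "\<And>\<eta> a. \<eta> > 0 \<Longrightarrow> a \<in> unit_cube \<Longrightarrow> \<exists>c. \<forall>x\<in>unit_cube.
        \<bar>g x - (\<Sum>ks | length ks \<le> n. c ks * monomial ks x)\<bar> \<le> l1 (x - a) ^ n + \<eta>"
      by (rule sobolev_polynomial_approximation[OF f assms]) blast
    have "\<exists>Net :: 'd network. rational_network Net \<and> real (network_size Net) \<le> S \<epsilon> \<and>
        real (network_depth Net) \<le> real D \<and> sup_norm (\<lambda>x. g x - network_fun Net x) \<le> ereal \<epsilon>"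
      if e: "0 < \<epsilon>" "\<epsilon> < 1" for \<epsilon>
    proof -
      \<comment> \<open>Half of \<epsilon> is spent on the grid width, the other half on the \<eta>
        of the local polynomials.\<close>
      obtain N :: nat where N: "N > 0" "C / real N ^ n \<le> \<epsilon> / 2"
        "real N + 1 \<le> A * \<epsilon> powr (- (1 / real n))"
        using grid_resolution[OF C assms e] unfolding A_def by blast
      have node: "(1 / real N) *\<^sub>R m \<in> unit_cube" if m: "m \<in> grid N" for m :: "real^'d"
        unfolding mem_box_cart
      proof (intro allI conjI)
        fix i
        have "m $ i \<in> real ` {..N}" using m by (simp add: grid_def)
        then have "0 \<le> m $ i" "m $ i \<le> real N" by auto
        then show "0 $ i \<le> ((1 / real N) *\<^sub>R m) $ i" "((1 / real N) *\<^sub>R m) $ i \<le> 1 $ i"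
          using N(1) by (simp_all add: divide_simps)
      qed
      have "\<forall>m\<in>grid N. \<exists>c. \<forall>x\<in>unit_cube. \<bar>g x - (\<Sum>ks | length ks \<le> n. c ks * monomial ks x)\<bar>
          \<le> l1 (x - (1 / real N) *\<^sub>R m) ^ n + \<epsilon> / 2"
        by (intro ballI poly node half_gt_zero e(1))
      from bchoice[OF this] obtain c where c: "\<forall>m\<in>grid N. \<forall>x\<in>unit_cube.
          \<bar>g x - (\<Sum>ks | length ks \<le> n. c m ks * monomial ks x)\<bar> \<le> l1 (x - (1 / real N) *\<^sub>R m) ^ n + \<epsilon> / 2" ..
      obtain Net :: "'d network" where Net: "rational_network Net"
        "network_size Net \<le> M * (N + 1) ^ CARD('d)" "network_depth Net \<le> D"
        "\<And>x. x \<in> unit_cube \<Longrightarrow> network_fun Net x =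
          (\<Sum>m\<in>grid N. shepard_weight (2 ^ q) (real N *\<^sub>R x - m) * (\<Sum>ks | length ks \<le> n. c m ks * monomial ks x))
          / (\<Sum>m\<in>grid N. shepard_weight (2 ^ q) (real N *\<^sub>R x - m))"
        using net[of N c] by blast
      have "\<bar>g x - network_fun Net x\<bar> \<le> \<epsilon>" if x: "x \<in> unit_cube" for x
      proof -
        have "\<bar>g x - network_fun Net x\<bar> \<le> C / real N ^ n + \<epsilon> / 2"
          unfolding Net(4)[OF x] C_def by (rule shepard_error[OF K N(1) x]) (use c x in blast)
        then show ?thesis using N(2) by linarith
      qed
      then have "sup_norm (\<lambda>x. g x - network_fun Net x) \<le> ereal \<epsilon>"
        unfolding sup_norm_def by (intro SUP_least) simp
      moreover have "real (network_size Net) \<le> S \<epsilon>"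
      proof -
        have "real (network_size Net) \<le> real M * (real N + 1) ^ CARD('d)"
          using of_nat_mono[OF Net(2), where 'a = real] by (simp add: add.commute)
        also have "\<dots> \<le> real M * (A * \<epsilon> powr (- (1 / real n))) ^ CARD('d)"
          using N(3) by (intro mult_left_mono power_mono) auto
        also have "(A * \<epsilon> powr (- (1 / real n))) ^ CARD('d) = A ^ CARD('d) * \<epsilon> powr (- (real CARD('d) / real n))"
          using e by (simp add: power_mult_distrib powr_powr flip: powr_realpow)
        finally show ?thesis by (simp add: S_def mult_ac)
      qed
      ultimately show ?thesis using Net(1,3) by (intro exI[of _ Net]) simp
    qed
    then show "\<exists>g. continuous_representative f g \<and>
        (\<forall>\<epsilon>. 0 < \<epsilon> \<and> \<epsilon> < 1 \<longrightarrow>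
          (\<exists>N :: 'd network. rational_network N \<and>
            real (network_size N) \<le> S \<epsilon> \<and>
            real (network_depth N) \<le> real D \<and>
            sup_norm (\<lambda>x. g x - network_fun N x) \<le> ereal \<epsilon>))"
      using rep by blast
  qed
qed

end
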